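(* Let $X(t)$ be a self-dual Hunt process on a state space $D$ with a finite reference measure $m$, and consider the Fleming--Viot system of two particles evolving according to $X(t)$, started on the diagonal of $D\times D$. Assume that the branching times are finite with probability one, i.e. for $m$-almost every $x\in D$, $\bar{\mathbb P}^{x,x}(\tau_n<\infty\text{ for all }n)=1$. Let $Z_0=\bar X(0)=\bar Y(0)$ and, for $n\ge1$, let $Z_n$ denote the position of the surviving particle at the $n$th branching time $\tau_n$. Then $(Z_n)_{n\ge0}$ is a conservative Markov chain on $D$ (it is a Markov chain and, for $m$-almost every starting point $Z_0=x$, with probability one $Z_n\in D$ for all $n$), and $m$ is a stationary measure for $(Z_n)$: $\int_D\bar{\mathbb P}^{x,x}(Z_1\in A)\,m(dx)=m(A)$ for every Borel $A\subseteq D$.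
   Context: Hunt process: $X(t)$ is a Hunt process with state space $D$, cemetery point $\partial$ and lifetime $\zeta\in(0,\infty]$ (possibly finite), with law $\mathbb P^x$ when $X(0)=x$; $X(t)=\partial$ for $t\ge\zeta$. Its transition operators are $P_tf(x)=\mathbb E^x f(X(t))$, with the convention $f(\partial)=0$ for functions $f$ on $D$. Self-dual with reference measure $m$: $m$ is a measure on $D$ such that the operators $P_t$ are self-adjoint on $L^2(D,m)$. Fleming--Viot system of two particles $(\bar X(t),\bar Y(t))$ started at $(x,y)\in D\times D$ (law $\bar{\mathbb P}^{x,y}$): set $\tau_0=0$. Let $X_1,Y_1$ be independent copies of $X$ started at $x$ and $y$, with lifetimes $\zeta^{X_1},\zeta^{Y_1}$. Recursively, for $n\ge 1$, let $\sigma_n=\min\{\zeta^{X_n},\zeta^{Y_n}\}$, $\tau_n=\tau_{n-1}+\sigma_n$, and $\bar X(\tau_{n-1}+t)=X_n(t)$, $\bar Y(\tau_{n-1}+t)=Y_n(t)$ for $t\in[0,\sigma_n)$. If $\sigma_n<\infty$, let $Z_n=X_n(\zeta^{Y_n})$ when $\zeta^{Y_n}<\zeta^{X_n}$ and $Z_n=Y_n(\zeta^{X_n})$ when $\zeta^{X_n}<\zeta^{Y_n}$ (the position of the surviving particle); given the past, $X_{n+1},Y_{n+1}$ are then independent copies of $X$ both started at $Z_n$. If $\sigma_n=\infty$ the construction ends and $\tau_k=\infty$ for all $k\ge n$. If $\zeta^{X_n}=\zeta^{Y_n}<\infty$, then $Z_n=\partial$, the construction stops, and $\tau_k=\tau_n$,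 $Z_k=\partial$ for $k\ge n$. The $\tau_n$, $n\ge1$, are the branching times. *)

theory Defs
  imports "HOL-Probability.Probability"
begin

section \<open>Hunt processes\<close>

definition borel_sets_of :: "'a topology \<Rightarrow> 'a measure" where
  "borel_sets_of T = sigma (topspace T) {U. openin T U}"

text \<open>
  The cemetery is \<^term>\<open>None\<close>: the state space with the cemetery adjoined is the one-point
  compactification of \<open>D\<close> (in which \<^term>\<open>None\<close> is isolated if \<open>D\<close> is compact).
\<close>

abbreviation with_cemetery :: "'a topology \<Rightarrow> 'a option topology" where
  "with_cemetery D \<equiv> Alexandroff_compactification D"

abbreviation state_algebra :: "'a topology \<Rightarrow> 'a option measure" where
  "state_algebra D \<equiv> borel_sets_of (with_cemetery D)"

text \<open>
  Time is \<open>[0,\<infinity>]\<close>, rendered as \<^typ>\<open>ennreal\<close>, with \<open>X \<infinity> = None\<close>. So the infimum below is over a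
  nonempty set, and stopping times may be infinite.
\<close>

definition lifetime :: "(ennreal \<Rightarrow> 'w \<Rightarrow> 'a option) \<Rightarrow> 'w \<Rightarrow> ennreal" where
  "lifetime X \<omega> = Inf {t. X t \<omega> = None}"

abbreviation cond_prob_given :: "'w measure \<Rightarrow> 'w measure \<Rightarrow> 'w set \<Rightarrow> 'w \<Rightarrow> real" where
  "cond_prob_given M G A \<equiv> real_cond_exp M G (indicator A)"

text \<open>
  Hunt processes in the sense of Fukushima, Oshima and Takeda (Dirichlet Forms and Symmetric Markov
  Processes, Appendix A.2). The simple Markov property is the strong one at a constant time.
  As \<open>P\<close> is a kernel, the properties required under every \<open>P x\<close> hold under
  \<open>\<integral> P x \<mu>(dx)\<close> for every initial distribution \<open>\<mu>\<close>.
\<close>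

locale hunt_process = filtration "space \<Omega>" F
  for D :: "'a topology"
    and \<Omega> :: "'w measure"
    and F :: "ennreal \<Rightarrow> 'w measure"
    and P :: "'a option \<Rightarrow> 'w measure"
    and X :: "ennreal \<Rightarrow> 'w \<Rightarrow> 'a option" +
  assumes state_space:
      "locally_compact_space D" "metrizable_space D" "second_countable D"
    and filtration_sub: "\<And>t. sets (F t) \<subseteq> sets \<Omega>"
    and filtration_right_continuous: "\<And>t. t < \<infinity> \<Longrightarrow> sets (F t) = (\<Inter>s\<in>{t<..}. sets (F s))"
    and adapted: "\<And>t. X t \<in> F t \<rightarrow>\<^sub>M state_algebra D"
    and kernel: "P \<in> state_algebra D \<rightarrow>\<^sub>M prob_algebra \<Omega>"
    and start: "\<And>x. x \<in> topspace (with_cemetery D) \<Longrightarrow> AE \<omega> in P x. X 0 \<omega> = x"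
    and at_infinity: "\<And>\<omega>. \<omega> \<in> space \<Omega> \<Longrightarrow> X \<infinity> \<omega> = None"
    and absorbed: "\<And>\<omega> t. \<omega> \<in> space \<Omega> \<Longrightarrow> lifetime X \<omega> \<le> t \<Longrightarrow> X t \<omega> = None"
    and shifts: "\<And>t. t < \<infinity> \<Longrightarrow>
      \<exists>\<theta> \<in> space \<Omega> \<rightarrow> space \<Omega>. \<forall>\<omega>\<in>space \<Omega>. \<forall>s. X s (\<theta> \<omega>) = X (t + s) \<omega>"
    and right_continuous: "\<And>\<omega> t. \<omega> \<in> space \<Omega> \<Longrightarrow> t < \<infinity> \<Longrightarrow>
      limitin (with_cemetery D) (\<lambda>s. X s \<omega>) (X t \<omega>) (at_right t)"
    and left_limits: "\<And>\<omega> t. \<omega> \<in> space \<Omega> \<Longrightarrow> 0 < t \<Longrightarrow> t < \<infinity> \<Longrightarrow>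
      \<exists>l. limitin (with_cemetery D) (\<lambda>s. X s \<omega>) l (at_left t)"
    and strong_markov: "\<And>x T s A. x \<in> topspace (with_cemetery D) \<Longrightarrow> stopping_time F T \<Longrightarrow>
      A \<in> sets (state_algebra D) \<Longrightarrow>
      AE \<omega> in P x. cond_prob_given (P x) (pre_sigma T) {\<omega> \<in> space \<Omega>. X (T \<omega> + s) \<omega> \<in> A} \<omega>
        = measure (P (X (T \<omega>) \<omega>)) {\<omega>' \<in> space \<Omega>. X s \<omega>' \<in> A}"
    and quasi_left_continuous: "\<And>x T. x \<in> topspace (with_cemetery D) \<Longrightarrow>
      (\<And>n::nat. stopping_time F (T n)) \<Longrightarrow>
      (\<And>n \<omega>. \<omega> \<in> space \<Omega> \<Longrightarrow> T n \<omega> \<le> T (Suc n) \<omega>) \<Longrightarrow>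
      AE \<omega> in P x. (SUP n. T n \<omega>) < \<infinity> \<longrightarrow>
        limitin (with_cemetery D) (\<lambda>n. X (T n \<omega>) \<omega>) (X (SUP n. T n \<omega>) \<omega>) sequentially"

section \<open>Self-duality\<close>

definition transition_op ::
  "('a option \<Rightarrow> 'w measure) \<Rightarrow> (ennreal \<Rightarrow> 'w \<Rightarrow> 'a option) \<Rightarrow> ennreal \<Rightarrow> ('a \<Rightarrow> real) \<Rightarrow> 'a \<Rightarrow> real" where
  "transition_op P X t f x = (\<integral>\<omega>. (case X t \<omega> of None \<Rightarrow> 0 | Some y \<Rightarrow> f y) \<partial>P (Some x))"

definition square_integrable :: "'a measure \<Rightarrow> ('a \<Rightarrow> real) \<Rightarrow> bool" where
  "square_integrable m f \<longleftrightarrow> f \<in> borel_measurable m \<and> integrable m (\<lambda>x. (f x)\<^sup>2)"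

definition self_dual ::
  "'a topology \<Rightarrow> ('a option \<Rightarrow> 'w measure) \<Rightarrow> (ennreal \<Rightarrow> 'w \<Rightarrow> 'a option) \<Rightarrow> 'a measure \<Rightarrow> bool" where
  "self_dual D P X m \<longleftrightarrow>
     sets m = sets (borel_sets_of D) \<and>
     (\<forall>t f. t < \<infinity> \<longrightarrow> square_integrable m f \<longrightarrow> square_integrable m (transition_op P X t f)) \<and>
     (\<forall>t f g. t < \<infinity> \<longrightarrow> square_integrable m f \<longrightarrow> square_integrable m g \<longrightarrow>
        (\<integral>x. transition_op P X t f x * g x \<partial>m) = (\<integral>x. f x * transition_op P X t g x \<partial>m))"

section \<open>The Fleming--Viot system of two particles\<close>

text \<open>
  The copies of \<open>X\<close> driving the two particles in the \<open>n\<close>-th epoch \<open>[\<tau> n, \<tau> (Suc n))\<close>, counted from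
  \<open>n = 0\<close>, are \<open>\<lambda>t w. X t (\<xi> n w)\<close> and \<open>\<lambda>t w. X t (\<eta> n w)\<close> for random elements \<open>\<xi> n\<close>, \<open>\<eta> n\<close>
  of the sample space of \<open>X\<close>.
\<close>

definition survivor :: "(ennreal \<Rightarrow> 'w \<Rightarrow> 'a option) \<Rightarrow> 'w \<Rightarrow> 'w \<Rightarrow> 'a option" where
  "survivor X \<omega> \<omega>' =
     (if lifetime X \<omega>' < lifetime X \<omega> then X (lifetime X \<omega>') \<omega>
      else if lifetime X \<omega> < lifetime X \<omega>' then X (lifetime X \<omega>) \<omega>'
      else None)"

fun branching_time ::
  "(ennreal \<Rightarrow> 'w \<Rightarrow> 'a option) \<Rightarrow> (nat \<Rightarrow> 'n \<Rightarrow> 'w) \<Rightarrow> (nat \<Rightarrow> 'n \<Rightarrow> 'w) \<Rightarrow> nat \<Rightarrow> 'n \<Rightarrow> ennreal" where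
  "branching_time X \<xi> \<eta> 0 w = 0"
| "branching_time X \<xi> \<eta> (Suc n) w =
     branching_time X \<xi> \<eta> n w + min (lifetime X (\<xi> n w)) (lifetime X (\<eta> n w))"

text \<open>
  The pair of particles at time \<open>t\<close>; the least \<open>n\<close> with \<open>t < \<tau> (Suc n)\<close> is the epoch containing \<open>t\<close>.
\<close>

definition particles ::
  "(ennreal \<Rightarrow> 'w \<Rightarrow> 'a option) \<Rightarrow> (nat \<Rightarrow> 'n \<Rightarrow> 'w) \<Rightarrow> (nat \<Rightarrow> 'n \<Rightarrow> 'w) \<Rightarrow> ennreal \<Rightarrow> 'n \<Rightarrow>
     'a option \<times> 'a option" where
  "particles X \<xi> \<eta> t w =
     (if \<exists>n. t < branching_time X \<xi> \<eta> (Suc n) w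
      then let n = (LEAST n. t < branching_time X \<xi> \<eta> (Suc n) w);
               s = t - branching_time X \<xi> \<eta> n w
           in (X s (\<xi> n w), X s (\<eta> n w))
      else (None, None))"

text \<open>
  \<open>Z 0\<close> is the common initial position; it is only meant for systems started on the diagonal.
\<close>

definition Z_chain ::
  "(ennreal \<Rightarrow> 'w \<Rightarrow> 'a option) \<Rightarrow> (nat \<Rightarrow> 'n \<Rightarrow> 'w) \<Rightarrow> (nat \<Rightarrow> 'n \<Rightarrow> 'w) \<Rightarrow> nat \<Rightarrow> 'n \<Rightarrow> 'a option" where
  "Z_chain X \<xi> \<eta> n w =
     (case n of 0 \<Rightarrow> fst (particles X \<xi> \<eta> 0 w) | Suc k \<Rightarrow> survivor X (\<xi> k w) (\<eta> k w))"

text \<open>The \<open>\<sigma>\<close>-algebra generated by \<open>U 0, \<dots>, U n\<close>.\<close>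

definition past :: "'n measure \<Rightarrow> 's measure \<Rightarrow> (nat \<Rightarrow> 'n \<Rightarrow> 's) \<Rightarrow> nat \<Rightarrow> 'n measure" where
  "past N S U n = vimage_algebra (space N) (\<lambda>w. \<lambda>i\<in>{..n}. U i w) (PiM {..n} (\<lambda>_. S))"

text \<open>
  \<open>fleming_viot \<Omega> P X x y N \<xi> \<eta>\<close>: under \<open>N\<close>, the sequences \<open>\<xi>\<close>, \<open>\<eta>\<close> drive the system started at
  \<open>(x, y)\<close>. Once the construction has stopped, because both particles died simultaneously or both
  live forever, the survivor is \<^term>\<open>None\<close>; copies of \<open>X\<close> started at the cemetery stay there and have
  lifetime 0 almost surely, so that from then on \<open>Z\<close> stays at \<^term>\<open>None\<close> and the branching times
  remain constant.
\<close>

definition fleming_viot ::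
  "'w measure \<Rightarrow> ('a option \<Rightarrow> 'w measure) \<Rightarrow> (ennreal \<Rightarrow> 'w \<Rightarrow> 'a option) \<Rightarrow> 'a \<Rightarrow> 'a \<Rightarrow>
     'n measure \<Rightarrow> (nat \<Rightarrow> 'n \<Rightarrow> 'w) \<Rightarrow> (nat \<Rightarrow> 'n \<Rightarrow> 'w) \<Rightarrow> bool" where
  "fleming_viot \<Omega> P X x y N \<xi> \<eta> \<longleftrightarrow>
     prob_space N \<and>
     (\<forall>n. \<xi> n \<in> N \<rightarrow>\<^sub>M \<Omega>) \<and> (\<forall>n. \<eta> n \<in> N \<rightarrow>\<^sub>M \<Omega>) \<and>
     distr N (\<Omega> \<Otimes>\<^sub>M \<Omega>) (\<lambda>w. (\<xi> 0 w, \<eta> 0 w)) = P (Some x) \<Otimes>\<^sub>M P (Some y) \<and>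
     (\<forall>n. \<forall>B\<in>sets \<Omega>. \<forall>C\<in>sets \<Omega>. AE w in N.
        cond_prob_given N (past N (\<Omega> \<Otimes>\<^sub>M \<Omega>) (\<lambda>i w. (\<xi> i w, \<eta> i w)) n)
          {w \<in> space N. \<xi> (Suc n) w \<in> B \<and> \<eta> (Suc n) w \<in> C} w
        = measure (P (Z_chain X \<xi> \<eta> (Suc n) w)) B * measure (P (Z_chain X \<xi> \<eta> (Suc n) w)) C)"

section \<open>Markov chains\<close>

text \<open>Time-homogeneous Markov chains with state space \<open>S\<close> and one-step transition kernel \<open>K\<close>.\<close>

definition markov_chain ::
  "'n measure \<Rightarrow> 's measure \<Rightarrow> ('s \<Rightarrow> 's measure) \<Rightarrow> (nat \<Rightarrow> 'n \<Rightarrow> 's) \<Rightarrow> bool" where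
  "markov_chain N S K Z \<longleftrightarrow>
     K \<in> S \<rightarrow>\<^sub>M prob_algebra S \<and>
     (\<forall>n. Z n \<in> N \<rightarrow>\<^sub>M S) \<and>
     (\<forall>n. \<forall>A\<in>sets S. AE w in N.
        cond_prob_given N (past N S Z n) {w \<in> space N. Z (Suc n) w \<in> A} w = measure (K (Z n w)) A)"

text \<open>
  The law of \<open>Z 1\<close> under \<open>Pbar z\<close>, the law of the system started at \<open>(z, z)\<close>, with
  \<^term>\<open>None\<close> absorbing.
\<close>

definition Z_kernel ::
  "'a topology \<Rightarrow> (ennreal \<Rightarrow> 'w \<Rightarrow> 'a option) \<Rightarrow> ('a \<Rightarrow> 'n measure) \<Rightarrow> (nat \<Rightarrow> 'n \<Rightarrow> 'w) \<Rightarrow>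
     (nat \<Rightarrow> 'n \<Rightarrow> 'w) \<Rightarrow> 'a option \<Rightarrow> 'a option measure" where
  "Z_kernel D X Pbar \<xi> \<eta> z =
     (case z of None \<Rightarrow> return (state_algebra D) None
      | Some x \<Rightarrow> distr (Pbar x) (state_algebra D) (Z_chain X \<xi> \<eta> 1))"

end

theory Submission
  imports Defs
begin

text \<open>
  Let \<open>\<zeta>\<close> be the lifetime of the second of two independent copies of \<open>X\<close> started at \<open>x\<close>. By symmetry
  the law of the survivor restricted to \<open>D\<close> is twice the law of the position of the first copy at
  time \<open>\<zeta>\<close>. Discretise \<open>\<zeta>\<close> by a grid of mesh \<open>h\<close>: if \<open>k h < \<zeta> \<le> (k + 1) h\<close>, observe the first copy at
  time \<open>(k + j) h\<close>. Since \<open>P\<^sub>s 1\<close> is the probability of survival until \<open>s\<close>, duality turns the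
  \<open>m\<close>-integral of the probability that this happens and the observed position lies in \<open>A\<close> into
  \<open>g ((2 k + j) h) - g ((2 k + j + 1) h)\<close>, where \<open>g s\<close> is the integral of \<open>P\<^sub>s 1\<close> over \<open>A\<close>. Adding the
  offsets \<open>j = 2\<close> and \<open>j = 3\<close>, whose terms interlace, gives the telescoping sum \<open>g (2 h)\<close>, and this
  accounts for the factor two. The observation times decrease to \<open>\<zeta>\<close> as \<open>h\<close> tends to \<open>0\<close>, so right
  continuity yields an inequality on open sets; the total masses agree, and since closed sets are
  countable intersections of open sets, the measures coincide. Equality of the total masses also
  rules out simultaneous deaths.
\<close>

section \<open>The state space\<close>

lemma space_borel_sets_of [simp]: "space (borel_sets_of T) = topspace T"
  and sets_borel_sets_of: "sets (borel_sets_of T) = sigma_sets (topspace T) {U. openin T U}"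
proof -
  have sub: "{U. openin T U} \<subseteq> Pow (topspace T)"
    using openin_subset by blast
  show "space (borel_sets_of T) = topspace T"
    and "sets (borel_sets_of T) = sigma_sets (topspace T) {U. openin T U}"
    using sub by (simp_all add: borel_sets_of_def space_measure_of sets_measure_of)
qed

lemma sets_borel_sets_ofI: "openin T U \<Longrightarrow> U \<in> sets (borel_sets_of T)"
  by (simp add: sets_borel_sets_of sigma_sets.Basic)

lemma borel_sets_of_closedin: "closedin T C \<Longrightarrow> C \<in> sets (borel_sets_of T)"
  using sets.compl_sets[OF sets_borel_sets_ofI, of T "topspace T - C"]
  by (simp add: closedin_def double_diff)

lemma sets_borel_sets_of_subset: "A \<in> sets (borel_sets_of T) \<Longrightarrow> A \<subseteq> topspace T"
  using sets.sets_into_space[of A "borel_sets_of T"] by simp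

text \<open>An intersection-stable generator that mentions only open sets of \<open>D\<close>.
  Measurability of maps into the state space and equality of finite measures can be tested on it, so
  that neighbourhoods of the cemetery never have to be treated.\<close>

definition cemetery_generator :: "'a topology \<Rightarrow> 'a option set set" where
  "cemetery_generator D = insert (topspace (with_cemetery D)) ((`) Some ` {U. openin D U})"

lemma cemetery_generator_subset: "cemetery_generator D \<subseteq> Pow (topspace (with_cemetery D))"
  by (auto simp: cemetery_generator_def dest: openin_subset)

text \<open>Neighbourhoods of the cemetery are complements of sets \<open>Some ` C\<close> with \<open>C\<close> closed in \<open>D\<close>.\<close>

lemma sets_state_algebra:
  "sets (state_algebra D) = sigma_sets (topspace (with_cemetery D)) (cemetery_generator D)"
    (is "_ = sigma_sets ?T ?G")
proof -
  interpret S: sigma_algebra ?T "sigma_sets ?T ?G"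
    by (rule sigma_algebra_sigma_sets[OF cemetery_generator_subset])
  have "V \<in> sigma_sets ?T ?G" if V: "openin (with_cemetery D) V" for V
  proof -
    consider U where "openin D U" "V = Some ` U"
      | C where "closedin D C" "V = insert None (Some ` (topspace D - C))"
      using V by (auto simp: openin_Alexandroff_compactification)
    then show ?thesis
    proof cases
      case 1
      then show ?thesis
        by (intro sigma_sets.Basic) (auto simp: cemetery_generator_def)
    next
      case 2
      have "Some ` topspace D - Some ` (topspace D - C) \<in> sigma_sets ?T ?G"
        using 2 by (intro S.Diff sigma_sets.Basic) (auto simp: cemetery_generator_def)
      then have "?T - (Some ` topspace D - Some ` (topspace D - C)) \<in> sigma_sets ?T ?G"
        by (rule sigma_sets.Compl)
      also have "?T - (Some ` topspace D - Some ` (topspace D - C)) = V"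
        using 2 by auto
      finally show ?thesis .
    qed
  qed
  moreover have "U \<in> sigma_sets ?T {U. openin (with_cemetery D) U}" if "U \<in> ?G" for U
    using that by (intro sigma_sets.Basic) (auto simp: cemetery_generator_def
        openin_topspace simp del: topspace_Alexandroff_compactification)
  ultimately show ?thesis
    unfolding sets_borel_sets_of by (intro sigma_sets_eqI) auto
qed

lemma Int_stable_cemetery_generator: "Int_stable (cemetery_generator D)"
proof (rule Int_stableI)
  fix A B assume "A \<in> cemetery_generator D" "B \<in> cemetery_generator D"
  moreover have "Some ` U \<inter> Some ` V = Some ` (U \<inter> V)" for U V :: "'a set"
    by auto
  moreover have "topspace (with_cemetery D) \<inter> Some ` U = Some ` U" if "openin D U" for U
    using openin_subset[OF that] by auto
  ultimately show "A \<inter> B \<in> cemetery_generator D"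
    unfolding cemetery_generator_def
    by (smt (verit, del_insts) image_iff inf.idem inf_commute insert_iff mem_Collect_eq openin_Int)
qed

lemma measurable_state_algebraI:
  assumes "f \<in> space M \<rightarrow> topspace (with_cemetery D)"
    and "\<And>U. openin D U \<Longrightarrow> {w \<in> space M. f w \<in> Some ` U} \<in> sets M"
  shows "f \<in> M \<rightarrow>\<^sub>M state_algebra D"
proof (rule measurable_sigma_sets[OF sets_state_algebra cemetery_generator_subset assms(1)])
  fix A assume "A \<in> cemetery_generator D"
  then consider "A = topspace (with_cemetery D)" | U where "openin D U" "A = Some ` U"
    by (auto simp: cemetery_generator_def)
  then show "f -` A \<inter> space M \<in> sets M"
  proof cases
    case 1
    have "f -` A \<inter> space M = space M"
      using assms(1) 1 by blast
    then show ?thesis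
      by simp
  next
    case 2
    have "f -` A \<inter> space M = {w \<in> space M. f w \<in> Some ` U}"
      using 2 by auto
    then show ?thesis
      using assms(2)[OF 2(1)] by simp
  qed
qed

lemma measurable_Some_state_algebra [measurable]: "Some \<in> borel_sets_of D \<rightarrow>\<^sub>M state_algebra D"
proof (rule measurable_state_algebraI)
  fix U assume "openin D U"
  moreover have "{x \<in> space (borel_sets_of D). Some x \<in> Some ` U} = topspace D \<inter> U"
    by auto
  ultimately show "{x \<in> space (borel_sets_of D). Some x \<in> Some ` U} \<in> sets (borel_sets_of D)"
    by (simp add: sets_borel_sets_ofI openin_Int)
qed auto

lemma image_Some_state_algebra:
  assumes "A \<in> sets (borel_sets_of D)"
  shows "Some ` A \<in> sets (state_algebra D)"
  using assms unfolding sets_borel_sets_of[of D]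
proof (induction rule: sigma_sets.induct)
  case (Basic U)
  then show ?case
    by (simp add: sets_borel_sets_ofI)
next
  case Empty
  then show ?case
    by simp
next
  case (Compl A)
  \<comment> \<open>The complement is taken inside \<open>D\<close>, not inside the
    compactification, hence a difference of two images.\<close>
  have "Some ` (topspace D - A) = Some ` topspace D - Some ` A"
    by auto
  then show ?case
    using Compl by (simp add: sets_borel_sets_ofI sets.Diff)
next
  case (Union A)
  then show ?case
    unfolding image_UN by (intro sets.countable_UN) auto
qed

lemma singleton_None_state_algebra: "{None} \<in> sets (state_algebra D)"
proof -
  have "{None} = space (state_algebra D) - Some ` topspace D"
    by auto
  also have "\<dots> \<in> sets (state_algebra D)"
    by (intro sets.compl_sets) (simp add: sets_borel_sets_ofI)
  finally show ?thesis .
qed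

text \<open>Each point of \<open>U\<close> is interior to some \<open>C k\<close>. Thus a convergent
  sequence with limit in \<open>U\<close> eventually stays in one closed set \<open>C k\<close>, and
  conversely a sequence staying in \<open>C k\<close> has its limit in \<open>U\<close>.\<close>

lemma metrizable_open_exhaustion:
  assumes "metrizable_space D" "openin D U"
  obtains C :: "nat \<Rightarrow> 'a set" where
    "\<And>k. closedin D (C k)" "\<And>k. C k \<subseteq> U" "\<And>x. x \<in> U \<Longrightarrow> \<exists>k V. openin D V \<and> x \<in> V \<and> V \<subseteq> C k"
proof -
  obtain S d where "Metric_space S d" and D: "D = Metric_space.mtopology S d"
    using assms(1) unfolding metrizable_space_def by metis
  interpret Metric_space S d by fact
  have [simp]: "topspace D = S"
    by (simp add: D)
  \<comment> \<open>The points at distance at least 1/(k+1) from the complement of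
    \<open>U\<close>.\<close>
  define C where "C k = S - (\<Union>y\<in>S - U. mball y (inverse (Suc k)))" for k
  show ?thesis
  proof
    show "closedin D (C k)" for k
    proof -
      have "openin D (\<Union>y\<in>S - U. mball y (inverse (Suc k)))"
        by (auto simp: D)
      then show ?thesis
        using openin_closedin_eq[of D] by (metis C_def \<open>topspace D = S\<close> closedin_diff closedin_topspace)
    qed
    show "C k \<subseteq> U" for k
    proof
      fix x assume x: "x \<in> C k"
      show "x \<in> U"
      proof (rule ccontr)
        assume "x \<notin> U"
        then have "x \<in> S - U" "x \<in> mball x (inverse (Suc k))"
          using x by (auto simp: C_def)
        then show False
          using x unfolding C_def by blast
      qed
    qed
    fix x assume "x \<in> U"
    then obtain r where r: "r > 0" "mball x r \<subseteq> U" and x: "x \<in> S"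
      using assms(2) unfolding D openin_mtopology by blast
    \<comment> \<open>A point within 1/(k+1) both of \<open>x\<close> and of some \<open>y\<close>
      outside \<open>U\<close> would put \<open>y\<close> at distance less than r from
      \<open>x\<close>; hence half the radius.\<close>
    obtain k where k: "inverse (real (Suc k)) < r / 2"
      using reals_Archimedean[of "r / 2"] r by auto
    have "mball x (inverse (Suc k)) \<subseteq> C k"
    proof
      fix z assume z: "z \<in> mball x (inverse (Suc k))"
      have False if "y \<in> S" "y \<notin> U" "z \<in> mball y (inverse (Suc k))" for y
      proof -
        have "d x y \<le> d x z + d y z"
          using triangle[of x z y] z that x by (auto simp: commute)
        also have "\<dots> < r"
          using z that k by simp
        finally have "y \<in> mball x r"
          using x that by simp
        then show False
          using r that by blast
      qed
      then show "z \<in> C k"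
        using z by (auto simp: C_def)
    qed
    then show "\<exists>k V. openin D V \<and> x \<in> V \<and> V \<subseteq> C k"
      using x by (intro exI[of _ k] exI[of _ "mball x (inverse (Suc k))"]) (auto simp: D)
  qed
qed

section \<open>Measurability at random times\<close>

definition grid_time :: "nat \<Rightarrow> nat \<Rightarrow> ennreal" where
  "grid_time n k = ennreal (real k / real (Suc n))"

text \<open>For positive finite \<open>t\<close> this is the cell containing \<open>t\<close>. The
  cells are open on the left and closed on the right, because dying in a cell then means being alive
  at its left end and dead at its right end. At 0 and at infinity the value is 0 by default.\<close>

definition grid_index :: "nat \<Rightarrow> ennreal \<Rightarrow> nat" where
  "grid_index n t = nat \<lceil>real (Suc n) * enn2real t\<rceil> - 1"

lemma grid_time_finite [simp]: "grid_time n k < \<infinity>" "grid_time n k \<noteq> \<infinity>" "grid_time n k \<noteq> top"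
  by (simp_all add: grid_time_def)

lemma grid_time_add: "grid_time n i + grid_time n j = grid_time n (i + j)"
  by (simp add: grid_time_def add_divide_distrib flip: ennreal_plus)

lemma grid_time_mono: "i \<le> j \<Longrightarrow> grid_time n i \<le> grid_time n j"
  by (auto simp: grid_time_def intro!: ennreal_leI divide_right_mono)

lemma measurable_grid_index [measurable]: "grid_index n \<in> borel \<rightarrow>\<^sub>M count_space UNIV"
  unfolding grid_index_def by measurable

lemma grid_index_eq_iff:
  assumes "0 < t" "t < \<infinity>"
  shows "grid_index n t = k \<longleftrightarrow> grid_time n k < t \<and> t \<le> grid_time n (Suc k)"
proof -
  obtain r where r: "t = ennreal r" "0 < r"
    using assms by (cases t) auto
  have "grid_index n t = k \<longleftrightarrow> \<lceil>real (Suc n) * r\<rceil> = int (Suc k)"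
  proof -
    define c where "c = \<lceil>real (Suc n) * r\<rceil>"
    have "0 < c"
      using r by (simp add: c_def)
    moreover have "grid_index n t = nat c - 1"
      using r by (simp add: grid_index_def c_def)
    ultimately show ?thesis
      unfolding c_def[symmetric] by linarith
  qed
  also have "\<dots> \<longleftrightarrow> real k < real (Suc n) * r \<and> real (Suc n) * r \<le> real (Suc k)"
    by (simp add: ceiling_eq_iff)
  also have "\<dots> \<longleftrightarrow> real k / real (Suc n) < r \<and> r \<le> real (Suc k) / real (Suc n)"
    by (simp add: divide_less_eq le_divide_eq mult.commute)
  also have "\<dots> \<longleftrightarrow> grid_time n k < t \<and> t \<le> grid_time n (Suc k)"
    using r by (simp add: grid_time_def ennreal_less_iff ennreal_le_iff del: of_nat_Suc)
  finally show ?thesis .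
qed

text \<open>With offset 1 the grid time would equal \<open>t\<close> whenever \<open>t\<close> is a
  positive grid point; from offset 2 on it is strictly larger, and it exceeds \<open>t\<close> by at
  most j/(n+1). Strictness is needed to converge along \<open>at_right t\<close>.\<close>

lemma grid_time_index_at_right:
  assumes "t < \<infinity>" "2 \<le> j"
  shows grid_time_index_gt: "t < grid_time n (grid_index n t + j)"
    and "filterlim (\<lambda>n. grid_time n (grid_index n t + j)) (at_right t) sequentially"
proof -
  obtain r where r: "t = ennreal r" "0 \<le> r"
    using assms(1) by (cases t) auto
  define q where "q n = real (grid_index n t + j) / real (Suc n)" for n
  have lower: "r < q n" and upper: "q n \<le> r + j / real (Suc n)" for n
  proof -
    have "real (Suc n) * r < real (grid_index n t + j)"
      using assms(2) r unfolding grid_index_def by simp linarith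
    then show "r < q n"
      unfolding q_def by (simp add: less_divide_eq mult.commute)
    define c where "c = \<lceil>real (Suc n) * r\<rceil>"
    have "0 \<le> real (Suc n) * r"
      using r by simp
    moreover from this have "0 \<le> c" "real_of_int c < real (Suc n) * r + 1"
      unfolding c_def by linarith+
    moreover have "grid_index n t = nat c - 1"
      using r by (simp add: grid_index_def c_def)
    ultimately have "real (grid_index n t) \<le> real (Suc n) * r"
      by linarith
    then have "real (grid_index n t + j) \<le> (r + j / real (Suc n)) * real (Suc n)"
      by (simp add: ring_distribs mult.commute del: of_nat_Suc)
    then show "q n \<le> r + j / real (Suc n)"
      unfolding q_def by (simp add: divide_le_eq)
  qed
  have gt: "t < grid_time n (grid_index n t + j)" for n
    using lower[of n] r unfolding grid_time_def q_def[symmetric] by (simp add: ennreal_less_iff)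
  then show "t < grid_time n (grid_index n t + j)" .
  have "(\<lambda>n. r + j / real (Suc n)) \<longlonglongrightarrow> r + 0"
    by (intro tendsto_intros lim_const_over_n[THEN LIMSEQ_Suc])
  then have "q \<longlonglongrightarrow> r"
    using lower upper
    by (intro tendsto_sandwich[of "\<lambda>_. r" q sequentially "\<lambda>n. r + j / real (Suc n)" r])
      (auto simp: less_imp_le)
  then have "(\<lambda>n. grid_time n (grid_index n t + j)) \<longlonglongrightarrow> t"
    unfolding grid_time_def q_def[symmetric] by (subst r(1)) (rule tendsto_ennrealI)
  then show "filterlim (\<lambda>n. grid_time n (grid_index n t + j)) (at_right t) sequentially"
    using gt by (auto simp: filterlim_at less_imp_neq[symmetric])
qed

section \<open>Lifetimes and positions at random times\<close>

context hunt_process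
begin

text \<open>By \<open>absorbed\<close> the infimum defining the lifetime is attained and death is
  permanent. Events about lifetimes thereby become events about single coordinates.\<close>

lemma X_None_iff: "\<omega> \<in> space \<Omega> \<Longrightarrow> X t \<omega> = None \<longleftrightarrow> lifetime X \<omega> \<le> t"
  using absorbed by (auto simp: lifetime_def intro: Inf_lower)

lemma X_None_mono: "\<omega> \<in> space \<Omega> \<Longrightarrow> X s \<omega> = None \<Longrightarrow> s \<le> t \<Longrightarrow> X t \<omega> = None"
  by (simp add: X_None_iff)

lemma measurable_X [measurable]: "X t \<in> \<Omega> \<rightarrow>\<^sub>M state_algebra D"
  using adapted[of t] filtration_sub[of t] by (auto simp: measurable_def space_F)

lemma X_in: "\<omega> \<in> space \<Omega> \<Longrightarrow> X t \<omega> \<in> insert None (Some ` topspace D)"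
  using measurable_space[OF measurable_X] by simp

lemma X_Some_iff: "\<omega> \<in> space \<Omega> \<Longrightarrow> X t \<omega> \<in> Some ` topspace D \<longleftrightarrow> t < lifetime X \<omega>"
  using X_in[of \<omega> t] X_None_iff[of \<omega> t] by (auto simp: not_le)

lemma measurable_lifetime [measurable]: "lifetime X \<in> borel_measurable \<Omega>"
proof (rule borel_measurableI_le)
  fix t
  have "{\<omega> \<in> space \<Omega>. lifetime X \<omega> \<le> t} = X t -` {None} \<inter> space \<Omega>"
    using X_None_iff by auto
  also have "\<dots> \<in> sets \<Omega>"
    by (rule measurable_sets[OF measurable_X singleton_None_state_algebra])
  finally show "{\<omega> \<in> space \<Omega>. lifetime X \<omega> \<le> t} \<in> sets \<Omega>" .
qed

lemma prob_space_P: "z \<in> topspace (with_cemetery D) \<Longrightarrow> prob_space (P z)"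
  and sets_P: "z \<in> topspace (with_cemetery D) \<Longrightarrow> sets (P z) = sets \<Omega>"
  using measurable_space[OF kernel, of z] by (auto simp: space_prob_algebra)

lemma space_P: "z \<in> topspace (with_cemetery D) \<Longrightarrow> space (P z) = space \<Omega>"
  using sets_P by (rule sets_eq_imp_space_eq)

lemma eventually_right_in:
  assumes "\<omega> \<in> space \<Omega>" "t < \<infinity>" "X t \<omega> \<in> Some ` U" "openin D U"
  shows "eventually (\<lambda>s. X s \<omega> \<in> Some ` U) (at_right t)"
  using right_continuous[OF assms(1,2)] assms(3,4) by (simp add: limitin_def)

lemma eventually_grid_in:
  assumes "\<omega> \<in> space \<Omega>" "t < \<infinity>" "2 \<le> j" "X t \<omega> \<in> Some ` U" "openin D U"
  shows "eventually (\<lambda>n. X (grid_time n (grid_index n t + j)) \<omega> \<in> Some ` U) sequentially"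
  using eventually_compose_filterlim[OF eventually_right_in grid_time_index_at_right(2)] assms
  by blast

text \<open>
  Right continuity exhibits the value at a random time as a limit of values at countably valued
  times; membership of the limit in an open set is decided by closed sets exhausting it.
\<close>

lemma measurable_X_random_time:
  assumes f [measurable]: "f \<in> M \<rightarrow>\<^sub>M \<Omega>" and t [measurable]: "t \<in> borel_measurable M"
  shows "(\<lambda>w. X (t w) (f w)) \<in> M \<rightarrow>\<^sub>M state_algebra D"
proof (rule measurable_state_algebraI)
  have f_in: "f w \<in> space \<Omega>" if "w \<in> space M" for w
    using measurable_space[OF f that] .
  show "(\<lambda>w. X (t w) (f w)) \<in> space M \<rightarrow> topspace (with_cemetery D)"
    using X_in f_in by auto
  fix U assume U: "openin D U"
  obtain C :: "nat \<Rightarrow> 'a set" where C: "\<And>k. closedin D (C k)" "\<And>k. C k \<subseteq> U"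
      "\<And>x. x \<in> U \<Longrightarrow> \<exists>k V. openin D V \<and> x \<in> V \<and> V \<subseteq> C k"
    by (rule metrizable_open_exhaustion[OF state_space(2) U]) metis
  \<comment> \<open>Approximation from the right by countably valued times; 2 is the smallest offset
    that keeps them strictly after \<open>t w\<close>.\<close>
  define Y where "Y n w = X (grid_time n (grid_index n (t w) + 2)) (f w)" for n :: nat and w
  have Y [measurable]: "Y n \<in> M \<rightarrow>\<^sub>M state_algebra D" for n
  proof -
    have "(\<lambda>w. X (grid_time n (i + 2)) (f w)) \<in> M \<rightarrow>\<^sub>M state_algebra D" for i
      by (rule measurable_compose[OF f measurable_X])
    moreover have "(\<lambda>w. grid_index n (t w)) \<in> M \<rightarrow>\<^sub>M count_space UNIV"
      by measurable
    ultimately show ?thesis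
      unfolding Y_def
      by (rule measurable_compose_countable[where f = "\<lambda>i w. X (grid_time n (i + 2)) (f w)"
            and g = "\<lambda>w. grid_index n (t w)"])
  qed
  have [measurable]: "Some ` C k \<in> sets (state_algebra D)" for k
    by (intro image_Some_state_algebra borel_sets_of_closedin C)
  have iff: "X (t w) (f w) \<in> Some ` U \<longleftrightarrow>
      t w < \<infinity> \<and> (\<exists>k N. \<forall>n\<in>{N..}. Y n w \<in> Some ` C k)" if w: "w \<in> space M" for w
  proof
    assume L: "X (t w) (f w) \<in> Some ` U"
    \<comment> \<open>At time infinity the process is at the cemetery, so a position in
      \<open>U\<close> forces a finite time.\<close>
    then have fin: "t w < \<infinity>"
      using at_infinity[OF f_in[OF w]] by (cases "t w = \<infinity>") (auto simp: less_top)
    obtain x k V where x: "X (t w) (f w) = Some x" "openin D V" "x \<in> V" "V \<subseteq> C k"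
      using L C(3) by blast
    have "eventually (\<lambda>n. Y n w \<in> Some ` V) sequentially"
      unfolding Y_def by (rule eventually_grid_in) (use x fin f_in[OF w] in auto)
    then have "eventually (\<lambda>n. Y n w \<in> Some ` C k) sequentially"
      by (rule eventually_mono) (use x in auto)
    then show "t w < \<infinity> \<and> (\<exists>k N. \<forall>n\<in>{N..}. Y n w \<in> Some ` C k)"
      using fin unfolding eventually_sequentially by auto
  next
    assume R: "t w < \<infinity> \<and> (\<exists>k N. \<forall>n\<in>{N..}. Y n w \<in> Some ` C k)"
    then have fin: "t w < \<infinity>"
      by (rule conjunct1)
    from R obtain k n where kn: "\<forall>i\<in>{n..}. Y i w \<in> Some ` C k"
      by (elim conjE exE)
    then have k: "eventually (\<lambda>i. Y i w \<in> Some ` C k) sequentially"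
      by (intro eventually_sequentiallyI[of n]) simp
    have n: "Y n w \<in> Some ` C k"
      by (rule bspec[OF kn]) simp
    \<comment> \<open>The image of a closed subset of \<open>D\<close> need not be closed in the
      compactification, so the cemetery is excluded as a limit separately: death at
      \<open>t w\<close> would persist at the later grid time.\<close>
    have "X (t w) (f w) \<noteq> None"
    proof
      assume "X (t w) (f w) = None"
      from X_None_mono[OF f_in[OF w] this less_imp_le[OF grid_time_index_gt[OF fin order_refl, of n]]]
      have "Y n w = None"
        by (simp only: Y_def)
      then show False
        using n by (metis image_iff option.distinct(1))
    qed
    then obtain x where x: "X (t w) (f w) = Some x" "x \<in> topspace D"
      using X_in[OF f_in[OF w], of "t w"] by auto
    have "x \<in> C k"
    proof (rule ccontr)
      assume "x \<notin> C k"
      \<comment> \<open>A limit in the open complement of \<open>C k\<close> would pull the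
        approximations out of \<open>C k\<close>.\<close>
      have "eventually (\<lambda>n. Y n w \<in> Some ` (topspace D - C k)) sequentially"
        unfolding Y_def
        by (rule eventually_grid_in) (use x \<open>x \<notin> C k\<close> fin C(1) f_in[OF w] in auto)
      with k have "eventually (\<lambda>n::nat. False) sequentially"
        by eventually_elim auto
      then show False
        by simp
    qed
    then show "X (t w) (f w) \<in> Some ` U"
      using x C(2) by auto
  qed
  have "{w \<in> space M. X (t w) (f w) \<in> Some ` U} =
      {w \<in> space M. t w < \<infinity> \<and> (\<exists>k N. \<forall>n\<in>{N..}. Y n w \<in> Some ` C k)}"
    by (intro Collect_cong conj_cong refl iff)
  also have "\<dots> \<in> sets M"
    by measurable
  finally show "{w \<in> space M. X (t w) (f w) \<in> Some ` U} \<in> sets M" .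
qed

lemma measurable_survivor [measurable (raw)]:
  assumes [measurable]: "f \<in> M \<rightarrow>\<^sub>M \<Omega>" "g \<in> M \<rightarrow>\<^sub>M \<Omega>"
  shows "(\<lambda>w. survivor X (f w) (g w)) \<in> M \<rightarrow>\<^sub>M state_algebra D"
proof -
  note measurable_X_random_time [measurable]
  have [measurable]: "(\<lambda>w. None) \<in> M \<rightarrow>\<^sub>M state_algebra D"
    by (rule measurable_const) simp
  show ?thesis
    unfolding survivor_def by measurable
qed

end

section \<open>The survivor\<close>

context hunt_process
begin

section \<open>The law of the survivor of two independent copies\<close>

lemma measurable_X_P [measurable]:
  "z \<in> topspace (with_cemetery D) \<Longrightarrow> X t \<in> P z \<rightarrow>\<^sub>M state_algebra D"
  using measurable_X by (simp add: measurable_cong_sets[OF sets_P])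

lemma prob_space_P_pair:
  "z \<in> topspace (with_cemetery D) \<Longrightarrow> prob_space (P z \<Otimes>\<^sub>M P z)"
  by (intro prob_space_pair prob_space_P)

lemma sets_P_pair:
  "z \<in> topspace (with_cemetery D) \<Longrightarrow> sets (P z \<Otimes>\<^sub>M P z) = sets (\<Omega> \<Otimes>\<^sub>M \<Omega>)"
  by (intro sets_pair_measure_cong sets_P)

lemma AE_P_pair_snd:
  assumes z: "z \<in> topspace (with_cemetery D)"
    and Q: "{\<omega> \<in> space \<Omega>. Q \<omega>} \<in> sets \<Omega>" "AE \<omega> in P z. Q \<omega>"
  shows "AE p in P z \<Otimes>\<^sub>M P z. Q (snd p)"
proof -
  interpret Pz: prob_space "P z"
    using z by (rule prob_space_P)
  interpret pair_sigma_finite "P z" "P z"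
    by standard
  have [measurable]: "Measurable.pred (P z) Q"
    using Q(1) z by (simp add: pred_def space_P sets_P)
  show ?thesis
    by (rule AE_pair_measure) (use Q(2) in auto)
qed

text \<open>The transition kernel of the chain of survivors, defined from \<open>P\<close> alone; it
  is identified with \<open>Z_kernel\<close> in the end.\<close>

definition survivor_law :: "'a option \<Rightarrow> 'a option measure" where
  "survivor_law z = distr (P z \<Otimes>\<^sub>M P z) (state_algebra D) (\<lambda>p. survivor X (fst p) (snd p))"

lemma measurable_survivor_law: "survivor_law \<in> state_algebra D \<rightarrow>\<^sub>M prob_algebra (state_algebra D)"
  unfolding survivor_law_def
  by (rule measurable_compose[OF measurable_pair_prob[OF kernel kernel]])
    (rule measurable_distr_prob_space, measurable)

text \<open>Two copies started at the cemetery both have lifetime 0, and a tie of lifetimes yields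
  \<open>None\<close>.\<close>

lemma survivor_law_None: "survivor_law None = return (state_algebra D) None"
proof -
  have z: "None \<in> topspace (with_cemetery D)"
    by simp
  interpret PP: prob_space "P None \<Otimes>\<^sub>M P None"
    using z by (rule prob_space_P_pair)
  interpret P0: prob_space "P None"
    using z by (rule prob_space_P)
  interpret pair_sigma_finite "P None" "P None"
    by standard
  have dead: "AE \<omega> in P None. lifetime X \<omega> = 0"
    using start[OF z] AE_space
  proof eventually_elim
    case (elim \<omega>)
    then show ?case
      using X_None_iff[of \<omega> 0] z by (simp add: space_P)
  qed
  have [measurable]: "lifetime X \<in> borel_measurable (P None)"
    using measurable_lifetime by (simp add: measurable_cong_sets[OF sets_P])
  have "AE p in P None \<Otimes>\<^sub>M P None. lifetime X (fst p) = 0 \<and> lifetime X (snd p) = 0"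
    by (rule AE_pair_measure) (use dead in \<open>auto elim: eventually_mono\<close>)
  then have "survivor_law None = distr (P None \<Otimes>\<^sub>M P None) (state_algebra D) (\<lambda>_. None)"
    unfolding survivor_law_def
  proof (intro distr_cong_AE refl)
    assume "AE p in P None \<Otimes>\<^sub>M P None. lifetime X (fst p) = 0 \<and> lifetime X (snd p) = 0"
    then show "AE p in P None \<Otimes>\<^sub>M P None. survivor X (fst p) (snd p) = None"
      by eventually_elim (simp add: survivor_def)
    show "(\<lambda>p. survivor X (fst p) (snd p)) \<in> P None \<Otimes>\<^sub>M P None \<rightarrow>\<^sub>M state_algebra D"
      using measurable_survivor[OF measurable_fst measurable_snd]
      by (simp add: measurable_cong_sets[OF sets_P_pair])
  qed simp
  also have "\<dots> = return (state_algebra D) None"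
    by (rule PP.distr_const) simp
  finally show ?thesis .
qed

text \<open>Being in \<open>D\<close> at the death time of the second copy already encodes that the
  first strictly outlives it and that this time is finite, since otherwise the position is the
  cemetery.\<close>

definition survival_event :: "'a set \<Rightarrow> ('w \<times> 'w) set" where
  "survival_event A = {p \<in> space (\<Omega> \<Otimes>\<^sub>M \<Omega>). X (lifetime X (snd p)) (fst p) \<in> Some ` A}"

lemma sets_survival_event:
  assumes "A \<in> sets (borel_sets_of D)"
  shows "survival_event A \<in> sets (\<Omega> \<Otimes>\<^sub>M \<Omega>)"
proof -
  note [measurable] = image_Some_state_algebra[OF assms] measurable_X_random_time
  show ?thesis
    unfolding survival_event_def by measurable
qed

lemma survivor_in_iff:
  assumes "\<omega> \<in> space \<Omega>" "\<omega>' \<in> space \<Omega>"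
  shows "survivor X \<omega> \<omega>' \<in> Some ` A \<longleftrightarrow>
    X (lifetime X \<omega>') \<omega> \<in> Some ` A \<or> X (lifetime X \<omega>) \<omega>' \<in> Some ` A"
  using X_None_iff[OF assms(1), of "lifetime X \<omega>'"] X_None_iff[OF assms(2), of "lifetime X \<omega>"]
  by (auto simp: survivor_def)

text \<open>The survivor lies in \<open>A\<close> on the disjoint union of
  \<open>survival_event A\<close> and its image under exchanging the two copies, and the product of
  two equal laws is invariant under the exchange.\<close>

lemma emeasure_survivor_law:
  assumes z: "z \<in> topspace (with_cemetery D)" and A: "A \<in> sets (borel_sets_of D)"
  shows "emeasure (survivor_law z) (Some ` A) = 2 * emeasure (P z \<Otimes>\<^sub>M P z) (survival_event A)"
proof -
  interpret Pz: prob_space "P z"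
    using z by (rule prob_space_P)
  interpret pair_sigma_finite "P z" "P z"
    by standard
  let ?E = "survival_event A" and ?s = "\<lambda>p::'w \<times> 'w. (snd p, fst p)"
  note E = sets_survival_event[OF A]
  have s [measurable]: "?s \<in> \<Omega> \<Otimes>\<^sub>M \<Omega> \<rightarrow>\<^sub>M \<Omega> \<Otimes>\<^sub>M \<Omega>"
    by measurable
  have s_in: "?s -` ?E \<inter> space (\<Omega> \<Otimes>\<^sub>M \<Omega>) \<in> sets (\<Omega> \<Otimes>\<^sub>M \<Omega>)"
    using s E by (rule measurable_sets)
  have sp: "space (P z \<Otimes>\<^sub>M P z) = space (\<Omega> \<Otimes>\<^sub>M \<Omega>)"
    using z by (simp add: space_pair_measure space_P)
  have "emeasure (survivor_law z) (Some ` A) = emeasure (P z \<Otimes>\<^sub>M P z)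
      ((\<lambda>p. survivor X (fst p) (snd p)) -` Some ` A \<inter> space (P z \<Otimes>\<^sub>M P z))"
    unfolding survivor_law_def
    by (rule emeasure_distr) (auto simp: measurable_cong_sets[OF sets_P_pair[OF z]]
        intro!: measurable_survivor image_Some_state_algebra A)
  also have "(\<lambda>p. survivor X (fst p) (snd p)) -` Some ` A \<inter> space (P z \<Otimes>\<^sub>M P z)
      = ?E \<union> (?s -` ?E \<inter> space (\<Omega> \<Otimes>\<^sub>M \<Omega>))"
  proof (rule set_eqI)
    fix p
    show "p \<in> (\<lambda>p. survivor X (fst p) (snd p)) -` Some ` A \<inter> space (P z \<Otimes>\<^sub>M P z)
      \<longleftrightarrow> p \<in> ?E \<union> (?s -` ?E \<inter> space (\<Omega> \<Otimes>\<^sub>M \<Omega>))"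
      using survivor_in_iff[of "fst p" "snd p" A]
      unfolding sp by (simp add: survival_event_def space_pair_measure mem_Times_iff) blast
  qed
  also have "emeasure (P z \<Otimes>\<^sub>M P z) \<dots> =
      emeasure (P z \<Otimes>\<^sub>M P z) ?E + emeasure (P z \<Otimes>\<^sub>M P z) (?s -` ?E \<inter> space (\<Omega> \<Otimes>\<^sub>M \<Omega>))"
  proof (rule plus_emeasure[symmetric])
    \<comment> \<open>Each copy would have to outlive the other strictly.\<close>
    have False if "p \<in> ?E" "?s p \<in> ?E" for p
      using that X_None_iff[of "fst p" "lifetime X (snd p)"] X_None_iff[of "snd p" "lifetime X (fst p)"]
      by (auto simp: survival_event_def space_pair_measure)
    then show "?E \<inter> (?s -` ?E \<inter> space (\<Omega> \<Otimes>\<^sub>M \<Omega>)) = {}"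
      by blast
  qed (use E s_in z in \<open>simp_all add: sets_P_pair\<close>)
  also have "emeasure (P z \<Otimes>\<^sub>M P z) (?s -` ?E \<inter> space (\<Omega> \<Otimes>\<^sub>M \<Omega>)) = emeasure (P z \<Otimes>\<^sub>M P z) ?E"
  proof -
    have "emeasure (P z \<Otimes>\<^sub>M P z) ?E = emeasure (distr (P z \<Otimes>\<^sub>M P z) (P z \<Otimes>\<^sub>M P z) (\<lambda>(x, y). (y, x))) ?E"
      using distr_pair_swap by simp
    also have "\<dots> = emeasure (P z \<Otimes>\<^sub>M P z) ((\<lambda>(x, y). (y, x)) -` ?E \<inter> space (P z \<Otimes>\<^sub>M P z))"
      using E z by (intro emeasure_distr measurable_pair_swap') (simp add: sets_P_pair)
    also have "(\<lambda>(x, y). (y, x)) -` ?E \<inter> space (P z \<Otimes>\<^sub>M P z) = ?s -` ?E \<inter> space (\<Omega> \<Otimes>\<^sub>M \<Omega>)"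
      unfolding sp by auto
    finally show ?thesis ..
  qed
  finally show ?thesis
    by (simp add: mult_2)
qed

section \<open>Transition probabilities and survival probabilities\<close>

definition trans_prob :: "ennreal \<Rightarrow> 'a set \<Rightarrow> 'a \<Rightarrow> real" where
  "trans_prob t A x = measure (P (Some x)) {\<omega> \<in> space \<Omega>. X t \<omega> \<in> Some ` A}"

lemma sets_X_in [measurable]:
  "A \<in> sets (borel_sets_of D) \<Longrightarrow> {\<omega> \<in> space \<Omega>. X t \<omega> \<in> Some ` A} \<in> sets \<Omega>"
  using measurable_sets[OF measurable_X image_Some_state_algebra, of A t]
  by (simp add: vimage_def Int_def conj_commute)

lemma topspace_borel [measurable, simp]: "topspace D \<in> sets (borel_sets_of D)"
  using sets.top[of "borel_sets_of D"] by simp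

lemma trans_prob_nonneg [simp]: "0 \<le> trans_prob t A x"
  by (simp add: trans_prob_def)

lemma trans_prob_le_1: "x \<in> topspace D \<Longrightarrow> trans_prob t A x \<le> 1"
  unfolding trans_prob_def by (intro prob_space.prob_le_1 prob_space_P) simp

lemma measurable_trans_prob [measurable]:
  assumes "A \<in> sets (borel_sets_of D)"
  shows "trans_prob t A \<in> borel_measurable (borel_sets_of D)"
proof -
  have "(\<lambda>x. P (Some x)) \<in> borel_sets_of D \<rightarrow>\<^sub>M prob_algebra \<Omega>"
    using measurable_Some_state_algebra kernel by (rule measurable_compose)
  then show ?thesis
    unfolding trans_prob_def
    by (rule measurable_compose) (intro measurable_measure_prob_algebra sets_X_in assms)
qed

lemma trans_prob_antimono:
  assumes "x \<in> topspace D" "s \<le> t"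
  shows "trans_prob t (topspace D) x \<le> trans_prob s (topspace D) x"
proof -
  interpret Px: prob_space "P (Some x)"
    using assms by (intro prob_space_P) simp
  have "{\<omega> \<in> space \<Omega>. X t \<omega> \<in> Some ` topspace D} \<subseteq> {\<omega> \<in> space \<Omega>. X s \<omega> \<in> Some ` topspace D}"
    using assms(2) by (auto simp: X_Some_iff simp del: image_eqI cong: conj_cong)
  moreover have "{\<omega> \<in> space \<Omega>. X s \<omega> \<in> Some ` topspace D} \<in> sets (P (Some x))"
    using assms(1) sets_X_in[OF topspace_borel] by (simp add: sets_P)
  ultimately show ?thesis
    unfolding trans_prob_def by (rule Px.finite_measure_mono)
qed

lemma transition_op_cong:
  assumes "x \<in> topspace D" "\<And>y. y \<in> topspace D \<Longrightarrow> f y = g y"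
  shows "transition_op P X t f x = transition_op P X t g x"
  unfolding transition_op_def
proof (rule Bochner_Integration.integral_cong[OF refl])
  fix \<omega> assume "\<omega> \<in> space (P (Some x))"
  then have "\<omega> \<in> space \<Omega>"
    using assms by (simp add: space_P)
  from X_in[OF this, of t]
  show "(case X t \<omega> of None \<Rightarrow> 0 | Some y \<Rightarrow> f y) = (case X t \<omega> of None \<Rightarrow> 0 | Some y \<Rightarrow> g y)"
    using assms by auto
qed

lemma transition_op_indicator:
  assumes "x \<in> topspace D" "A \<in> sets (borel_sets_of D)"
  shows "transition_op P X t (indicator A) x = trans_prob t A x"
proof -
  have "transition_op P X t (indicator A) x
      = (\<integral>\<omega>. indicator {\<omega> \<in> space \<Omega>. X t \<omega> \<in> Some ` A} \<omega> \<partial>P (Some x))"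
    unfolding transition_op_def using assms
    by (intro Bochner_Integration.integral_cong)
      (auto simp: space_P indicator_def split: option.split)
  also have "{\<omega> \<in> space \<Omega>. X t \<omega> \<in> Some ` A} \<inter> space (P (Some x)) = {\<omega> \<in> space \<Omega>. X t \<omega> \<in> Some ` A}"
    using assms by (auto simp: space_P)
  then have "(\<integral>\<omega>. indicator {\<omega> \<in> space \<Omega>. X t \<omega> \<in> Some ` A} \<omega> \<partial>P (Some x)) = trans_prob t A x"
    unfolding trans_prob_def by simp
  finally show ?thesis .
qed

lemma subalgebra_pre_sigma:
  assumes "stopping_time F T" "x \<in> topspace (with_cemetery D)"
  shows "subalgebra (P x) (pre_sigma T)"
  unfolding subalgebra_def
proof
  show "space (pre_sigma T) = space (P x)"
    using assms by (simp add: space_pre_sigma space_P)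
  show "sets (pre_sigma T) \<subseteq> sets (P x)"
  proof
    fix A assume "A \<in> sets (pre_sigma T)"
    then have "\<forall>t. {\<omega> \<in> A. T \<omega> \<le> t} \<in> sets (F t)"
      using assms(1) by (simp add: sets_pre_sigma)
    \<comment> \<open>At \<open>top\<close> the condition on \<open>T\<close> is void, which leaves
      \<open>A\<close> itself.\<close>
    then have "{\<omega> \<in> A. T \<omega> \<le> top} \<in> sets (F top)" ..
    then show "A \<in> sets (P x)"
      using filtration_sub[of top] assms(2) by (auto simp: sets_P)
  qed
qed

lemma AE_alive_at_start:
  assumes "x \<in> topspace D"
  shows "AE \<omega> in P (Some x). 0 < lifetime X \<omega>"
proof -
  have "AE \<omega> in P (Some x). X 0 \<omega> = Some x"
    using assms by (intro start) simp
  then show ?thesis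
    using AE_space
  proof eventually_elim
  case (elim \<omega>)
  then have "X 0 \<omega> \<noteq> None" "\<omega> \<in> space \<Omega>"
    using assms by (auto simp: space_P)
  then show ?case
    using X_None_iff[of \<omega> 0] by (simp add: not_le zero_less_iff_neq_zero)
  qed
qed

text \<open>Reconciles the convention that \<open>transition_op\<close> gives the cemetery the value
  0 with the kernel \<open>P\<close> evaluated there.\<close>

lemma dead_start: "measure (P None) {\<omega> \<in> space \<Omega>. X t \<omega> \<in> Some ` A} = 0"
proof -
  have z: "None \<in> topspace (with_cemetery D)"
    by simp
  have "AE \<omega> in P None. \<not> X t \<omega> \<in> Some ` A"
    using start[OF z] AE_space
  proof eventually_elim
    case (elim \<omega>)
    then show ?case
      using X_None_mono[of \<omega> 0 t] z by (auto simp: space_P)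
  qed
  from emeasure_eq_0_AE[OF this] show ?thesis
    using z by (simp add: space_P measure_def)
qed

text \<open>The Markov property, which is the strong one at the constant stopping time
  \<open>t\<close>; integrating the conditional probability removes the conditioning.\<close>

lemma Chapman_Kolmogorov_survival:
  assumes x: "x \<in> topspace D" and "t < \<infinity>"
  shows "transition_op P X t (trans_prob s (topspace D)) x = trans_prob (t + s) (topspace D) x"
proof -
  let ?T = "\<lambda>_::'w. t" and ?B = "{\<omega> \<in> space \<Omega>. X (t + s) \<omega> \<in> Some ` topspace D}"
  have z: "Some x \<in> topspace (with_cemetery D)"
    using x by simp
  interpret Px: prob_space "P (Some x)"
    using z by (rule prob_space_P)
  interpret Px: finite_measure_subalgebra "P (Some x)" "pre_sigma ?T"
    by standard (intro subalgebra_pre_sigma stopping_time_const z)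
  have B: "?B \<in> sets (P (Some x))"
    using z sets_X_in[of "topspace D" "t + s"] by (simp add: sets_P)
  have "transition_op P X t (trans_prob s (topspace D)) x =
      (\<integral>\<omega>. measure (P (X t \<omega>)) {\<omega>' \<in> space \<Omega>. X s \<omega>' \<in> Some ` topspace D} \<partial>P (Some x))"
    unfolding transition_op_def
    by (intro Bochner_Integration.integral_cong) (auto simp: trans_prob_def dead_start split: option.split)
  also have "\<dots> = (\<integral>\<omega>. cond_prob_given (P (Some x)) (pre_sigma ?T) ?B \<omega> \<partial>P (Some x))"
  proof (rule integral_cong_AE)
    show "(\<lambda>\<omega>. measure (P (X t \<omega>)) {\<omega>' \<in> space \<Omega>. X s \<omega>' \<in> Some ` topspace D}) \<in> borel_measurable (P (Some x))"
      using z sets_X_in[OF topspace_borel]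
      by (intro measurable_compose[OF measurable_compose[OF measurable_X_P kernel] measurable_measure_prob_algebra]) auto
    show "AE \<omega> in P (Some x). measure (P (X t \<omega>)) {\<omega>' \<in> space \<Omega>. X s \<omega>' \<in> Some ` topspace D} =
        cond_prob_given (P (Some x)) (pre_sigma ?T) ?B \<omega>"
      using strong_markov[OF z stopping_time_const image_Some_state_algebra[OF topspace_borel], of t s]
      by eventually_elim simp
  qed simp
  also have "\<dots> = (\<integral>\<omega>. indicator ?B \<omega> \<partial>P (Some x))"
    using B by (intro Px.real_cond_exp_int integrable_real_indicator) (auto simp: Px.emeasure_eq_measure)
  also have "\<dots> = trans_prob (t + s) (topspace D) x"
    using B by (simp add: trans_prob_def sets.sets_into_space Int_absorb2)
  finally show ?thesis .
qed

end

section \<open>Stationarity\<close>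

text \<open>Finiteness of the branching times enters through \<open>lifetime_finite\<close>, a
  property of a single copy for almost every start.\<close>

locale self_dual_hunt_process = hunt_process D \<Omega> F P X + finite_measure m
  for D :: "'a topology" and \<Omega> :: "'w measure" and F P X and m :: "'a measure" +
  assumes self_dual: "self_dual D P X m"
    and lifetime_finite: "AE x in m. AE \<omega> in P (Some x). lifetime X \<omega> < \<infinity>"
begin

lemma sets_m: "sets m = sets (borel_sets_of D)"
  using self_dual by (simp add: self_dual_def)

lemma space_m [simp]: "space m = topspace D"
  using sets_eq_imp_space_eq[OF sets_m] by simp

lemma borel_m: "f \<in> borel_sets_of D \<rightarrow>\<^sub>M N \<Longrightarrow> f \<in> m \<rightarrow>\<^sub>M N"
  by (simp add: measurable_cong_sets[OF sets_m refl])

lemma measurable_trans_prob_m [measurable]: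
  "A \<in> sets (borel_sets_of D) \<Longrightarrow> trans_prob t A \<in> borel_measurable m"
  by (intro borel_m measurable_trans_prob)

lemma square_integrable_indicator:
  "A \<in> sets (borel_sets_of D) \<Longrightarrow> square_integrable m (indicator A)"
  unfolding square_integrable_def
  by (intro conjI integrable_const_bound[where B = 1] borel_measurable_power)
    (auto simp: sets_m power_le_one indicator_le_1 intro!: borel_measurable_indicator)

text \<open>Self-adjointness moves the operator at time \<open>t\<close> from the indicator of
  \<open>A\<close> onto the survival probability at time \<open>s\<close>, where the semigroup
  property merges the two times. Indicators are admissible because \<open>m\<close> is
  finite.\<close>

lemma duality:
  assumes "t < \<infinity>" "s < \<infinity>" and A: "A \<in> sets (borel_sets_of D)"
  shows "(\<integral>x. trans_prob t A x * trans_prob s (topspace D) x \<partial>m)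
    = (\<integral>x. indicator A x * trans_prob (t + s) (topspace D) x \<partial>m)"
proof -
  let ?f = "indicator A :: 'a \<Rightarrow> real" and ?g = "transition_op P X s (indicator (topspace D))"
  have f: "square_integrable m ?f" and g: "square_integrable m ?g"
    using self_dual assms(2) square_integrable_indicator[OF A]
      square_integrable_indicator[OF topspace_borel] by (auto simp: self_dual_def)
  have "(\<integral>x. trans_prob t A x * trans_prob s (topspace D) x \<partial>m) = (\<integral>x. transition_op P X t ?f x * ?g x \<partial>m)"
    using A by (intro Bochner_Integration.integral_cong) (simp_all add: transition_op_indicator)
  also have "\<dots> = (\<integral>x. ?f x * transition_op P X t ?g x \<partial>m)"
    using self_dual assms(1) f g unfolding self_dual_def by blast
  also have "\<dots> = (\<integral>x. indicator A x * trans_prob (t + s) (topspace D) x \<partial>m)"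
  proof (rule Bochner_Integration.integral_cong[OF refl])
    fix x assume "x \<in> space m"
    then have x: "x \<in> topspace D"
      by simp
    have "transition_op P X t ?g x = transition_op P X t (trans_prob s (topspace D)) x"
      using x by (rule transition_op_cong) (rule transition_op_indicator[OF _ topspace_borel])
    then show "?f x * transition_op P X t ?g x = indicator A x * trans_prob (t + s) (topspace D) x"
      using Chapman_Kolmogorov_survival[OF x assms(1)] by simp
  qed
  finally show ?thesis .
qed

section \<open>Survival masses: the function g of the sketch above, sampled on the grid\<close>

definition survival_mass :: "'a set \<Rightarrow> nat \<Rightarrow> nat \<Rightarrow> real" where
  "survival_mass A n i = (\<integral>x. indicator A x * trans_prob (grid_time n i) (topspace D) x \<partial>m)"

lemma integrable_trans_prob:
  assumes [measurable]: "A \<in> sets (borel_sets_of D)" "B \<in> sets (borel_sets_of D)"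
  shows "integrable m (\<lambda>x. trans_prob t A x * trans_prob s B x)"
  by (rule integrable_const_bound[where B = 1])
    (auto simp: abs_mult intro!: mult_le_one trans_prob_le_1 AE_I2)

lemma integrable_indicator_trans_prob:
  assumes A: "A \<in> sets (borel_sets_of D)" "B \<in> sets (borel_sets_of D)"
  shows "integrable m (\<lambda>x. indicator A x * trans_prob s B x)"
proof -
  have [measurable]: "A \<in> sets m" "trans_prob s B \<in> borel_measurable m"
    using A by (simp_all add: sets_m)
  show ?thesis
    by (rule integrable_const_bound[where B = 1])
      (auto simp: indicator_def intro!: trans_prob_le_1 AE_I2)
qed

lemma survival_mass_antimono:
  assumes "A \<in> sets (borel_sets_of D)" "i \<le> j"
  shows "survival_mass A n j \<le> survival_mass A n i"
  unfolding survival_mass_def using assms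
  by (intro integral_mono integrable_indicator_trans_prob mult_left_mono trans_prob_antimono grid_time_mono)
    auto

lemma survival_mass_le:
  assumes "A \<in> sets (borel_sets_of D)"
  shows "survival_mass A n i \<le> measure m A"
proof -
  have "survival_mass A n i \<le> (\<integral>x. indicator A x \<partial>m)"
    unfolding survival_mass_def using assms
    by (intro integral_mono integrable_indicator_trans_prob integrable_real_indicator)
      (auto simp: sets_m indicator_def emeasure_eq_measure intro!: trans_prob_le_1)
  also have "\<dots> = measure m A"
    using assms sets.sets_into_space[of A "borel_sets_of D"] by (simp add: Int_absorb2)
  finally show ?thesis .
qed

text \<open>For almost every start the lifetime is finite, so the survival probabilities decrease to
  0, and dominated convergence applies. Hence the later telescoping sum leaves no remainder at
  infinity.\<close>

lemma survival_mass_tendsto_0: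
  assumes A: "A \<in> sets (borel_sets_of D)"
  shows "survival_mass A n \<longlonglongrightarrow> 0"
proof -
  have [measurable]: "A \<in> sets m"
    using A by (simp add: sets_m)
  have "(\<lambda>i. \<integral>x. indicator A x * trans_prob (grid_time n i) (topspace D) x \<partial>m) \<longlonglongrightarrow> (\<integral>x. 0 \<partial>m)"
  proof (rule integral_dominated_convergence[where w = "\<lambda>_. 1"])
    show "AE x in m. (\<lambda>i. indicator A x * trans_prob (grid_time n i) (topspace D) x) \<longlonglongrightarrow> 0"
      using lifetime_finite AE_space
    proof eventually_elim
      case (elim x)
      then have x: "x \<in> topspace D"
        by simp
      interpret Px: prob_space "P (Some x)"
        using x by (intro prob_space_P) simp
      define B where "B i = {\<omega> \<in> space \<Omega>. X (grid_time n i) \<omega> \<in> Some ` topspace D}" for i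
      have B_eq: "B i = {\<omega> \<in> space \<Omega>. grid_time n i < lifetime X \<omega>}" for i
        unfolding B_def using X_Some_iff by (intro Collect_cong conj_cong refl)
      have B: "range B \<subseteq> sets (P (Some x))"
        using x sets_X_in[OF topspace_borel] by (auto simp: sets_P B_def)
      have "decseq B"
        unfolding B_eq by (intro antimonoI) (auto intro: le_less_trans grid_time_mono)
      with B have "(\<lambda>i. measure (P (Some x)) (B i)) \<longlonglongrightarrow> measure (P (Some x)) (\<Inter>i. B i)"
        by (intro Px.finite_Lim_measure_decseq) auto
      also have "measure (P (Some x)) (\<Inter>i. B i) = 0"
      proof -
        have "lifetime X \<omega> = \<infinity>" if "\<omega> \<in> (\<Inter>i. B i)" for \<omega>
        proof (rule ccontr)
          assume "lifetime X \<omega> \<noteq> \<infinity>"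
          then obtain r where r: "lifetime X \<omega> = ennreal r" "0 \<le> r"
            by (cases "lifetime X \<omega>") auto
          obtain i where "r * real (Suc n) < real i"
            using reals_Archimedean2 by blast
          then have "r < real i / real (Suc n)"
            by (simp add: less_divide_eq del: of_nat_Suc)
          then have "lifetime X \<omega> < grid_time n i"
            using r by (simp add: grid_time_def ennreal_less_iff)
          then show False
            using that by (auto simp: B_eq dest!: spec[of _ i])
        qed
        then have "AE \<omega> in P (Some x). \<omega> \<notin> (\<Inter>i. B i)"
          by (intro eventually_mono[OF elim(1)]) (metis less_irrefl)
        then have "(\<Inter>i. B i) \<in> null_sets (P (Some x))"
          using B by (subst AE_iff_null_sets) auto
        then show ?thesis
          by (simp add: measure_eq_0_null_sets)
      qed
      finally have "(\<lambda>i. trans_prob (grid_time n i) (topspace D) x) \<longlonglongrightarrow> 0"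
        by (simp add: trans_prob_def B_def)
      from tendsto_mult_right_zero[OF this] show ?case .
    qed
    show "AE x in m. norm (indicator A x * trans_prob (grid_time n i) (topspace D) x) \<le> 1" for i
      by (auto simp: indicator_def intro!: trans_prob_le_1 AE_I2)
  qed auto
  then show ?thesis
    by (simp add: survival_mass_def[abs_def])
qed

text \<open>Here the index is fixed and the mesh shrinks, so the grid time tends to 0, and a copy
  started in \<open>D\<close> has positive lifetime almost surely.\<close>

lemma survival_mass_at_start: "(\<lambda>n. survival_mass (topspace D) n i) \<longlonglongrightarrow> measure m (topspace D)"
proof -
  have "(\<lambda>n. \<integral>x. indicator (topspace D) x * trans_prob (grid_time n i) (topspace D) x \<partial>m) \<longlonglongrightarrow> (\<integral>x. 1 \<partial>m)"
  proof (rule integral_dominated_convergence[where w = "\<lambda>_. 1"])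
    show "AE x in m. (\<lambda>n. indicator (topspace D) x * trans_prob (grid_time n i) (topspace D) x) \<longlonglongrightarrow> 1"
    proof (rule AE_I2)
      fix x assume "x \<in> space m"
      then have x: "x \<in> topspace D"
        by simp
      interpret Px: prob_space "P (Some x)"
        using x by (intro prob_space_P) simp
      define B where "B n = {\<omega> \<in> space \<Omega>. X (grid_time n i) \<omega> \<in> Some ` topspace D}" for n
      have B_eq: "B n = {\<omega> \<in> space \<Omega>. grid_time n i < lifetime X \<omega>}" for n
        unfolding B_def using X_Some_iff by (intro Collect_cong conj_cong refl)
      have B: "range B \<subseteq> sets (P (Some x))"
        using x sets_X_in[OF topspace_borel] by (auto simp: sets_P B_def)
      \<comment> \<open>For fixed \<open>i\<close> the grid time i/(n+1) decreases in
        \<open>n\<close>, so the events of survival grow.\<close>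
      have "incseq B"
        unfolding B_eq
      proof (intro monoI Collect_mono conj_mono impI)
        fix k n \<omega> assume "k \<le> n" and le: "grid_time k i < lifetime X \<omega>"
        then have "grid_time n i \<le> grid_time k i"
          unfolding grid_time_def by (intro ennreal_leI divide_left_mono) auto
        with le show "grid_time n i < lifetime X \<omega>"
          by (rule order.strict_trans1[rotated])
      qed auto
      with B have "(\<lambda>n. measure (P (Some x)) (B n)) \<longlonglongrightarrow> measure (P (Some x)) (\<Union>n. B n)"
        by (intro Px.finite_Lim_measure_incseq) auto
      also have "measure (P (Some x)) (\<Union>n. B n) = 1"
      proof (rule Px.prob_eq_1[THEN iffD2])
        show "(\<Union>n. B n) \<in> Px.events"
          using B by auto
        show "AE \<omega> in P (Some x). \<omega> \<in> (\<Union>n. B n)"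
          using AE_alive_at_start[OF x] AE_space
        proof eventually_elim
          case (elim \<omega>)
          have "(\<lambda>n. real i / real (Suc n)) \<longlonglongrightarrow> 0"
            by (rule lim_const_over_n[THEN LIMSEQ_Suc])
          then have "(\<lambda>n. grid_time n i) \<longlonglongrightarrow> ennreal 0"
            unfolding grid_time_def by (rule tendsto_ennrealI)
          then have "eventually (\<lambda>n. grid_time n i < lifetime X \<omega>) sequentially"
            using elim(1) by (intro order_tendstoD) auto
          then obtain n where "grid_time n i < lifetime X \<omega>"
            using eventually_happens'[OF sequentially_bot] by blast
          then show ?case
            using elim(2) x by (auto simp: B_eq space_P)
        qed
      qed
      finally show "(\<lambda>n. indicator (topspace D) x * trans_prob (grid_time n i) (topspace D) x) \<longlonglongrightarrow> 1"
        using x by (simp add: trans_prob_def B_def)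
    qed
    show "AE x in m. norm (indicator (topspace D) x * trans_prob (grid_time n i) (topspace D) x) \<le> 1" for n
      by (auto simp: indicator_def intro!: trans_prob_le_1 AE_I2)
  qed (use sets.top[of m] in auto)
  then show ?thesis
    by (simp add: survival_mass_def)
qed

text \<open>
  The second particle dies in the grid interval number \<open>k\<close>, and the position of the first is
  observed at the grid time of index \<open>k + j\<close>.
\<close>

definition grid_cell :: "'a set \<Rightarrow> nat \<Rightarrow> nat \<Rightarrow> nat \<Rightarrow> ('w \<times> 'w) set" where
  "grid_cell A n j k = {\<omega> \<in> space \<Omega>. X (grid_time n (k + j)) \<omega> \<in> Some ` A} \<times>
     ({\<omega> \<in> space \<Omega>. X (grid_time n k) \<omega> \<in> Some ` topspace D} -
      {\<omega> \<in> space \<Omega>. X (grid_time n (Suc k)) \<omega> \<in> Some ` topspace D})"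

lemma mem_grid_cell_iff:
  "p \<in> grid_cell A n j k \<longleftrightarrow> p \<in> space (\<Omega> \<Otimes>\<^sub>M \<Omega>) \<and> X (grid_time n (k + j)) (fst p) \<in> Some ` A \<and>
    grid_time n k < lifetime X (snd p) \<and> lifetime X (snd p) \<le> grid_time n (Suc k)"
  using X_Some_iff[of "snd p" "grid_time n k"] X_Some_iff[of "snd p" "grid_time n (Suc k)"]
  unfolding grid_cell_def space_pair_measure mem_Times_iff by (auto simp: not_less simp del: image_eqI)

lemma sets_grid_cell:
  assumes "A \<in> sets (borel_sets_of D)"
  shows "grid_cell A n j k \<in> sets (\<Omega> \<Otimes>\<^sub>M \<Omega>)"
  unfolding grid_cell_def
  by (intro pair_measureI sets.Diff sets_X_in assms topspace_borel)

text \<open>Independence factors the probability of the cell into a transition probability at index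
  k+j times a difference of survival probabilities at indices k and k+1. By \<open>duality\<close>
  the indices add up, to 2k+j and 2k+j+1.\<close>

lemma nn_integral_grid_cell:
  assumes A: "A \<in> sets (borel_sets_of D)"
  shows "(\<integral>\<^sup>+x. emeasure (P (Some x) \<Otimes>\<^sub>M P (Some x)) (grid_cell A n j k) \<partial>m) =
    ennreal (survival_mass A n (2 * k + j) - survival_mass A n (Suc (2 * k + j)))"
proof -
  let ?p = "trans_prob (grid_time n (k + j)) A"
    and ?q = "trans_prob (grid_time n k) (topspace D)"
    and ?r = "trans_prob (grid_time n (Suc k)) (topspace D)"
  have "(\<integral>\<^sup>+x. emeasure (P (Some x) \<Otimes>\<^sub>M P (Some x)) (grid_cell A n j k) \<partial>m) =
      (\<integral>\<^sup>+x. ennreal (?p x * ?q x - ?p x * ?r x) \<partial>m)"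
  proof (rule nn_integral_cong)
    fix x assume "x \<in> space m"
    then have x: "x \<in> topspace D" and z: "Some x \<in> topspace (with_cemetery D)"
      by simp_all
    interpret Px: prob_space "P (Some x)"
      using z by (rule prob_space_P)
    let ?B = "\<lambda>k. {\<omega> \<in> space \<Omega>. X (grid_time n k) \<omega> \<in> Some ` topspace D}"
    have sets: "{\<omega> \<in> space \<Omega>. X t \<omega> \<in> Some ` C} \<in> sets (P (Some x))"
      if "C \<in> sets (borel_sets_of D)" for t C
      using sets_X_in[OF that] z by (simp add: sets_P)
    have "?B (Suc k) \<subseteq> ?B k"
      using X_None_mono[of _ "grid_time n k" "grid_time n (Suc k)"] grid_time_mono[of k "Suc k" n]
        X_in[of _ "grid_time n k"] by fastforce
    then have "measure (P (Some x)) (?B k - ?B (Suc k)) = ?q x - ?r x"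
      unfolding trans_prob_def by (intro Px.finite_measure_Diff sets topspace_borel)
    then have diff: "emeasure (P (Some x)) (?B k - ?B (Suc k)) = ennreal (?q x - ?r x)"
      by (simp only: Px.emeasure_eq_measure)
    have "emeasure (P (Some x) \<Otimes>\<^sub>M P (Some x)) (grid_cell A n j k) = ennreal (?p x) * ennreal (?q x - ?r x)"
      unfolding grid_cell_def diff[symmetric]
      by (subst Px.emeasure_pair_measure_Times)
        (auto simp only: sets sets.Diff A topspace_borel Px.emeasure_eq_measure trans_prob_def)
    also have "\<dots> = ennreal (?p x * (?q x - ?r x))"
      by (simp add: ennreal_mult')
    finally show "emeasure (P (Some x) \<Otimes>\<^sub>M P (Some x)) (grid_cell A n j k) = ennreal (?p x * ?q x - ?p x * ?r x)"
      by (simp only: right_diff_distrib)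
  qed
  also have "\<dots> = ennreal (\<integral>x. ?p x * ?q x - ?p x * ?r x \<partial>m)"
    using A by (intro nn_integral_eq_integral Bochner_Integration.integrable_diff integrable_trans_prob topspace_borel AE_I2)
      (auto intro!: mult_left_mono trans_prob_antimono grid_time_mono)
  also have "(\<integral>x. ?p x * ?q x - ?p x * ?r x \<partial>m) = (\<integral>x. ?p x * ?q x \<partial>m) - (\<integral>x. ?p x * ?r x \<partial>m)"
    using A by (intro Bochner_Integration.integral_diff integrable_trans_prob topspace_borel)
  also have "\<dots> = survival_mass A n (2 * k + j) - survival_mass A n (Suc (2 * k + j))"
  proof -
    have index: "2 * k + j = k + j + k" "Suc (k + j + k) = k + j + Suc k"
      by simp_all
    show ?thesis
      unfolding index survival_mass_def
      by (simp only: duality[OF grid_time_finite(1) grid_time_finite(1) A] grid_time_add)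
  qed
  finally show ?thesis .
qed

section \<open>Events summed over all grid cells, and the telescoping sum\<close>

definition grid_event :: "'a set \<Rightarrow> nat \<Rightarrow> nat \<Rightarrow> ('w \<times> 'w) set" where
  "grid_event A n j = (\<Union>k. grid_cell A n j k)"

text \<open>Turns the union of cells into one observation at a random grid time, to which right
  continuity applies. Lifetime 0 is excluded because it lies in no left-open cell.\<close>

lemma grid_event_iff:
  assumes "0 < lifetime X (snd p)" "lifetime X (snd p) < \<infinity>" "p \<in> space (\<Omega> \<Otimes>\<^sub>M \<Omega>)"
  shows "p \<in> grid_event A n j \<longleftrightarrow>
    X (grid_time n (grid_index n (lifetime X (snd p)) + j)) (fst p) \<in> Some ` A"
  using assms(3) unfolding grid_event_def UN_iff mem_grid_cell_iff grid_index_eq_iff[OF assms(1,2), symmetric]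
  by simp

lemma sets_grid_event: "A \<in> sets (borel_sets_of D) \<Longrightarrow> grid_event A n j \<in> sets (\<Omega> \<Otimes>\<^sub>M \<Omega>)"
  unfolding grid_event_def by (intro sets.countable_UN image_subsetI sets_grid_cell)

lemma disjoint_grid_cell: "disjoint_family (grid_cell A n j)"
proof -
  have "grid_cell A n j k \<inter> grid_cell A n j l = {}" if "k < l" for k l
  proof -
    have "grid_time n (Suc k) \<le> grid_time n l"
      using that by (intro grid_time_mono) simp
    then have False if "p \<in> grid_cell A n j k" "p \<in> grid_cell A n j l" for p
      using that unfolding mem_grid_cell_iff by (meson leD le_less_trans order_trans)
    then show ?thesis
      by blast
  qed
  then show ?thesis
    unfolding disjoint_family_on_def by (metis Int_commute linorder_neqE_nat)
qed

lemma measurable_emeasure_P_pair: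
  assumes "E \<in> sets (\<Omega> \<Otimes>\<^sub>M \<Omega>)"
  shows "(\<lambda>x. emeasure (P (Some x) \<Otimes>\<^sub>M P (Some x)) E) \<in> borel_measurable m"
proof (rule borel_m)
  have "(\<lambda>x. P (Some x)) \<in> borel_sets_of D \<rightarrow>\<^sub>M prob_algebra \<Omega>"
    using measurable_Some_state_algebra kernel by (rule measurable_compose)
  then have "(\<lambda>x. P (Some x) \<Otimes>\<^sub>M P (Some x)) \<in> borel_sets_of D \<rightarrow>\<^sub>M subprob_algebra (\<Omega> \<Otimes>\<^sub>M \<Omega>)"
    by (intro measurable_prob_algebraD measurable_pair_prob)
  then show "(\<lambda>x. emeasure (P (Some x) \<Otimes>\<^sub>M P (Some x)) E) \<in> borel_measurable (borel_sets_of D)"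
    by (rule measurable_compose) (intro measurable_emeasure_subprob_algebra assms)
qed

text \<open>Offset 2 contributes the decrements of the survival mass from index 2k+2 to 2k+3, offset
  3 those from 2k+3 to 2k+4. Together they exhaust the decrease from index 2 on.\<close>

lemma nn_integral_grid_events:
  assumes A: "A \<in> sets (borel_sets_of D)"
  shows "(\<integral>\<^sup>+x. emeasure (P (Some x) \<Otimes>\<^sub>M P (Some x)) (grid_event A n 2)
      + emeasure (P (Some x) \<Otimes>\<^sub>M P (Some x)) (grid_event A n 3) \<partial>m) = ennreal (survival_mass A n 2)"
proof -
  let ?Q = "\<lambda>x. P (Some x) \<Otimes>\<^sub>M P (Some x)" and ?G = "survival_mass A n"
  have event: "(\<integral>\<^sup>+x. emeasure (?Q x) (grid_event A n j) \<partial>m)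
      = (\<Sum>k. ennreal (?G (2 * k + j) - ?G (Suc (2 * k + j))))" for j
  proof -
    have "emeasure (?Q x) (grid_event A n j) = (\<Sum>k. emeasure (?Q x) (grid_cell A n j k))"
      if "x \<in> topspace D" for x
      unfolding grid_event_def using that sets_grid_cell[OF A]
      by (intro suminf_emeasure[symmetric] disjoint_grid_cell) (auto simp: sets_P_pair)
    then have "(\<integral>\<^sup>+x. emeasure (?Q x) (grid_event A n j) \<partial>m)
        = (\<integral>\<^sup>+x. (\<Sum>k. emeasure (?Q x) (grid_cell A n j k)) \<partial>m)"
      by (intro nn_integral_cong) simp
    also have "\<dots> = (\<Sum>k. \<integral>\<^sup>+x. emeasure (?Q x) (grid_cell A n j k) \<partial>m)"
      by (intro nn_integral_suminf measurable_emeasure_P_pair sets_grid_cell A)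
    finally show ?thesis
      using A by (simp add: nn_integral_grid_cell)
  qed
  have anti: "?G (Suc i) \<le> ?G i" for i
    using A by (intro survival_mass_antimono) simp_all
  have "(\<integral>\<^sup>+x. emeasure (?Q x) (grid_event A n 2) + emeasure (?Q x) (grid_event A n 3) \<partial>m)
      = (\<Sum>k. ennreal (?G (2 * k + 2) - ?G (Suc (2 * k + 2)))) + (\<Sum>k. ennreal (?G (2 * k + 3) - ?G (Suc (2 * k + 3))))"
    unfolding event[symmetric]
    by (intro nn_integral_add measurable_emeasure_P_pair sets_grid_event A)
  \<comment> \<open>The values at the odd indices cancel. Monotonicity makes the decrements
    nonnegative, so that their sums may be taken inside \<open>ennreal\<close>.\<close>
  also have "\<dots> = (\<Sum>k. ennreal (?G (2 * k + 2) - ?G (2 * Suc k + 2)))"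
    using anti by (subst suminf_add) (auto intro!: suminf_cong simp: numeral_eq_Suc simp flip: ennreal_plus)
  also have "\<dots> = ennreal (?G 2)"
  proof -
    have "(\<lambda>k. ?G (2 * k + 2)) \<longlonglongrightarrow> 0"
      by (rule LIMSEQ_subseq_LIMSEQ[OF survival_mass_tendsto_0[OF A], of "\<lambda>k. 2 * k + 2", unfolded comp_def])
        (auto simp: strict_mono_def)
    from telescope_sums'[OF this]
    have "(\<lambda>k. ?G (2 * k + 2) - ?G (2 * Suc k + 2)) sums ?G 2"
      by (simp add: numeral_2_eq_2)
    then show ?thesis
      using A by (intro suminf_ennreal_eq) (auto intro: survival_mass_antimono)
  qed
  finally show ?thesis .
qed

text \<open>
  Fatou: if the position at the death time lies in an open set, then so do the later grid positions
  of a fine grid.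
\<close>

lemma survivor_law_open_le:
  assumes U: "openin D U"
  shows "(\<integral>\<^sup>+x. emeasure (survivor_law (Some x)) (Some ` U) \<partial>m) \<le> emeasure m U"
proof -
  let ?Q = "\<lambda>x. P (Some x) \<Otimes>\<^sub>M P (Some x)"
  let ?e = "\<lambda>n x. emeasure (?Q x) (grid_event U n 2) + emeasure (?Q x) (grid_event U n 3)"
  have A: "U \<in> sets (borel_sets_of D)"
    using U by (rule sets_borel_sets_ofI)
  note sets = sets_grid_event[OF A] sets_survival_event[OF A]
  have "emeasure (survivor_law (Some x)) (Some ` U) \<le> liminf (\<lambda>n. ?e n x)" if x: "x \<in> topspace D" for x
  proof -
    have z: "Some x \<in> topspace (with_cemetery D)"
      using x by simp
    have sets_Q: "sets (?Q x) = sets (\<Omega> \<Otimes>\<^sub>M \<Omega>)"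
      using z by (rule sets_P_pair)
    let ?i = "\<lambda>n p. indicator (grid_event U n 2) p + indicator (grid_event U n 3) p :: ennreal"
    have "AE p in ?Q x. 0 < lifetime X (snd p)"
      by (rule AE_P_pair_snd[OF z _ AE_alive_at_start[OF x]]) measurable
    \<comment> \<open>A point of the survival event eventually lies in both grid events; this
      produces the 2 that matches \<open>emeasure_survivor_law\<close>.\<close>
    then have "AE p in ?Q x. 2 * indicator (survival_event U) p \<le> liminf (\<lambda>n. ?i n p)"
      using AE_space
    proof eventually_elim
      case (elim p)
      then have p: "p \<in> space (\<Omega> \<Otimes>\<^sub>M \<Omega>)"
        using sets_eq_imp_space_eq[OF sets_Q] by simp
      show ?case
      proof (cases "p \<in> survival_event U")
        case True
        then have in_U: "X (lifetime X (snd p)) (fst p) \<in> Some ` U"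
          by (simp add: survival_event_def)
        have \<omega>: "fst p \<in> space \<Omega>"
          using p by (auto simp: space_pair_measure)
        have fin: "lifetime X (snd p) < \<infinity>"
          using in_U at_infinity[OF \<omega>] by (cases "lifetime X (snd p) = \<infinity>") (auto simp: less_top)
        have event: "eventually (\<lambda>n. p \<in> grid_event U n j) sequentially" if "2 \<le> j" for j
          unfolding grid_event_iff[OF elim(1) fin p]
          by (rule eventually_grid_in[OF \<omega> fin that in_U U])
        have "(2::nat) \<le> 3"
          by simp
        from event[OF order_refl] event[OF this] have "eventually (\<lambda>n. 2 \<le> ?i n p) sequentially"
          by eventually_elim simp_all
        then have "2 \<le> liminf (\<lambda>n. ?i n p)"
          by (rule Liminf_bounded)
        then show ?thesis
          using True by simp
      qed simp
    qed
    then have "(\<integral>\<^sup>+p. 2 * indicator (survival_event U) p \<partial>?Q x) \<le> (\<integral>\<^sup>+p. liminf (\<lambda>n. ?i n p) \<partial>?Q x)"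
      by (rule nn_integral_mono_AE)
    also have "\<dots> \<le> liminf (\<lambda>n. \<integral>\<^sup>+p. ?i n p \<partial>?Q x)"
      using sets by (intro nn_integral_liminf borel_measurable_add borel_measurable_indicator) (auto simp: sets_Q)
    also have "(\<lambda>n. \<integral>\<^sup>+p. ?i n p \<partial>?Q x) = (\<lambda>n. ?e n x)"
      using sets by (subst nn_integral_add) (auto simp: sets_Q intro!: borel_measurable_indicator)
    also have "(\<integral>\<^sup>+p. 2 * indicator (survival_event U) p \<partial>?Q x) = 2 * emeasure (?Q x) (survival_event U)"
      using sets by (subst nn_integral_cmult) (auto simp: sets_Q intro!: borel_measurable_indicator)
    finally show ?thesis
      using emeasure_survivor_law[OF z A] by simp
  qed
  then have "(\<integral>\<^sup>+x. emeasure (survivor_law (Some x)) (Some ` U) \<partial>m) \<le> (\<integral>\<^sup>+x. liminf (\<lambda>n. ?e n x) \<partial>m)"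
    by (intro nn_integral_mono) simp
  \<comment> \<open>Fatou a second time, now over the starting points.\<close>
  also have "\<dots> \<le> liminf (\<lambda>n. \<integral>\<^sup>+x. ?e n x \<partial>m)"
    using sets by (intro nn_integral_liminf borel_measurable_add measurable_emeasure_P_pair)
  also have "\<dots> = liminf (\<lambda>n. ennreal (survival_mass U n 2))"
    using A by (simp add: nn_integral_grid_events)
  also have "\<dots> \<le> liminf (\<lambda>n::nat. emeasure m U)"
    using survival_mass_le[OF A] by (intro Liminf_mono) (auto simp: emeasure_eq_measure intro!: ennreal_leI)
  also have "\<dots> = emeasure m U"
    by (rule Liminf_const) simp
  finally show ?thesis .
qed

text \<open>
  If the first particle is alive at the later grid time, it is alive at the death time of the second.
\<close>

lemma survivor_law_total_ge:
  "emeasure m (topspace D) \<le> (\<integral>\<^sup>+x. emeasure (survivor_law (Some x)) (Some ` topspace D) \<partial>m)"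
proof (rule LIMSEQ_le_const2)
  let ?Q = "\<lambda>x. P (Some x) \<Otimes>\<^sub>M P (Some x)"
  show "(\<lambda>n. ennreal (survival_mass (topspace D) n 2)) \<longlonglongrightarrow> emeasure m (topspace D)"
    unfolding emeasure_eq_measure by (intro tendsto_ennrealI survival_mass_at_start)
  \<comment> \<open>Both grid events sit inside the survival event, and the two of them are matched
    by the factor two in the law of the survivor.\<close>
  have "ennreal (survival_mass (topspace D) n 2) \<le>
      (\<integral>\<^sup>+x. emeasure (survivor_law (Some x)) (Some ` topspace D) \<partial>m)" for n
    unfolding nn_integral_grid_events[OF topspace_borel, symmetric]
  proof (rule nn_integral_mono)
    fix x assume "x \<in> space m"
    then have z: "Some x \<in> topspace (with_cemetery D)"
      by simp
    have "emeasure (?Q x) (grid_event (topspace D) n j) \<le> emeasure (?Q x) (survival_event (topspace D))"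
      if "2 \<le> j" for j
    proof (rule emeasure_mono)
      show "grid_event (topspace D) n j \<subseteq> survival_event (topspace D)"
      proof
        fix p assume "p \<in> grid_event (topspace D) n j"
        then obtain k where k: "p \<in> space (\<Omega> \<Otimes>\<^sub>M \<Omega>)" "X (grid_time n (k + j)) (fst p) \<in> Some ` topspace D"
            "lifetime X (snd p) \<le> grid_time n (Suc k)"
          unfolding grid_event_def UN_iff mem_grid_cell_iff by blast
        moreover have "fst p \<in> space \<Omega>"
          using k(1) by (auto simp: space_pair_measure)
        moreover have "grid_time n (Suc k) \<le> grid_time n (k + j)"
          using that by (intro grid_time_mono) simp
        ultimately show "p \<in> survival_event (topspace D)"
          unfolding survival_event_def using X_Some_iff by (metis (lifting) mem_Collect_eq order.trans order.strict_trans1)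
      qed
      show "survival_event (topspace D) \<in> sets (?Q x)"
        using z by (simp add: sets_P_pair sets_survival_event)
    qed
    then show "emeasure (?Q x) (grid_event (topspace D) n 2) + emeasure (?Q x) (grid_event (topspace D) n 3)
        \<le> emeasure (survivor_law (Some x)) (Some ` topspace D)"
      unfolding emeasure_survivor_law[OF z topspace_borel] mult_2 by (intro add_mono) simp_all
  qed
  then show "\<exists>N. \<forall>n\<ge>N. ennreal (survival_mass (topspace D) n 2) \<le>
      (\<integral>\<^sup>+x. emeasure (survivor_law (Some x)) (Some ` topspace D) \<partial>m)"
    by blast
qed

section \<open>The law of the survivor integrated over starting points, cemetery included\<close>

definition next_law :: "'a option measure" where
  "next_law = m \<bind> (\<lambda>x. survivor_law (Some x))"

lemma measurable_survivor_law_Some: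
  "(\<lambda>x. survivor_law (Some x)) \<in> m \<rightarrow>\<^sub>M prob_algebra (state_algebra D)"
  by (intro borel_m measurable_compose[OF measurable_Some_state_algebra measurable_survivor_law])

text \<open>Nonemptiness enters because \<open>bind\<close> over an empty space takes a default
  value.\<close>

lemma emeasure_next_law:
  assumes "topspace D \<noteq> {}" "B \<in> sets (state_algebra D)"
  shows "emeasure next_law B = (\<integral>\<^sup>+x. emeasure (survivor_law (Some x)) B \<partial>m)"
  unfolding next_law_def using assms
  by (intro emeasure_bind[OF _ measurable_prob_algebraD[OF measurable_survivor_law_Some]]) auto

lemma sets_next_law:
  assumes "topspace D \<noteq> {}"
  shows "sets next_law = sets (state_algebra D)"
  unfolding next_law_def using assms
  by (intro sets_bind[OF sets_kernel[OF measurable_prob_algebraD[OF measurable_survivor_law_Some]]]) auto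

lemma measurable_Some_m: "Some \<in> m \<rightarrow>\<^sub>M state_algebra D"
  by (rule borel_m[OF measurable_Some_state_algebra])

lemma emeasure_distr_Some:
  assumes "A \<in> sets (borel_sets_of D)"
  shows "emeasure (distr m (state_algebra D) Some) (Some ` A) = emeasure m A"
proof -
  have "Some -` Some ` A \<inter> space m = A"
    using sets_borel_sets_of_subset[OF assms] by auto
  then show ?thesis
    using assms by (simp add: emeasure_distr measurable_Some_m image_Some_state_algebra)
qed

text \<open>On open sets one inequality is known and on \<open>D\<close> the masses agree. Once the
  same inequality holds for closed sets, passing to complements in \<open>D\<close> gives equality
  on open sets, and these together with the whole space form the generator.\<close>

lemma next_law_eq:
  assumes ne: "topspace D \<noteq> {}"
  shows "next_law = distr m (state_algebra D) Some"
proof -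
  let ?N = "distr m (state_algebra D) Some" and ?T = "topspace (with_cemetery D)"
  have le: "emeasure next_law (Some ` U) \<le> emeasure ?N (Some ` U)" if "openin D U" for U
    using survivor_law_open_le[OF that] that
    by (simp add: emeasure_next_law[OF ne] emeasure_distr_Some sets_borel_sets_ofI)
  have total: "emeasure next_law (Some ` topspace D) = emeasure m (topspace D)"
    using le[of "topspace D"] survivor_law_total_ge image_Some_state_algebra[OF topspace_borel]
    by (intro antisym) (simp_all add: emeasure_next_law[OF ne] emeasure_distr_Some)
  \<comment> \<open>The kernel has mass 1 at every start. Together with \<open>total\<close> this
    leaves no mass for the cemetery.\<close>
  have space: "emeasure next_law ?T = emeasure m (topspace D)"
  proof -
    have "emeasure next_law ?T = (\<integral>\<^sup>+x. emeasure (survivor_law (Some x)) ?T \<partial>m)"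
      using sets.top[of "state_algebra D"] by (simp add: emeasure_next_law[OF ne])
    also have "\<dots> = (\<integral>\<^sup>+x. 1 \<partial>m)"
      using measurable_space[OF measurable_survivor_law_Some]
        in_space_prob_algebra[of _ "state_algebra D"]
      by (intro nn_integral_cong) simp
    finally show ?thesis
      by simp
  qed
  have N_space: "emeasure ?N ?T = emeasure m (topspace D)"
  proof -
    have "Some -` ?T \<inter> space m = topspace D"
      by auto
    then show ?thesis
      using sets.top[of "state_algebra D"] by (simp add: emeasure_distr measurable_Some_m)
  qed
  interpret NL: finite_measure next_law
    using space sets_eq_imp_space_eq[OF sets_next_law[OF ne]]
    by (intro finite_measureI) (simp add: emeasure_eq_measure)
  interpret N: finite_measure ?N
    by (rule finite_measure_distr) (rule measurable_Some_m)
  have sets_NL [simp]: "B \<in> sets next_law \<longleftrightarrow> B \<in> sets (state_algebra D)" for B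
    using sets_next_law[OF ne] by simp
  \<comment> \<open>Closed sets of a metrizable space are decreasing intersections of open sets, and
    finite measures are continuous from above.\<close>
  have closed_le: "emeasure next_law (Some ` C) \<le> emeasure ?N (Some ` C)" if C: "closedin D C" for C
  proof -
    obtain G :: "nat \<Rightarrow> 'a set" where G: "\<And>n. openin D (G n)" "\<And>n. G (Suc n) \<subseteq> G n" "\<Inter>(range G) = C"
      using closed_imp_gdelta_in[OF state_space(2) C] unfolding gdelta_in_descending by metis
    have dec: "decseq (\<lambda>n. Some ` G n)"
      using G(2) by (intro decseq_SucI image_mono)
    have Int: "(\<Inter>n. Some ` G n) = Some ` C"
      unfolding G(3)[symmetric] using image_INT[of Some UNIV UNIV G 0] by simp
    have sets: "Some ` G n \<in> sets (state_algebra D)" for n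
      by (intro image_Some_state_algebra sets_borel_sets_ofI G)
    have "(\<lambda>n. emeasure next_law (Some ` G n)) \<longlonglongrightarrow> emeasure next_law (Some ` C)"
      unfolding Int[symmetric] using dec sets
      by (intro Lim_emeasure_decseq) (auto simp: NL.emeasure_eq_measure)
    moreover have "(\<lambda>n. emeasure ?N (Some ` G n)) \<longlonglongrightarrow> emeasure ?N (Some ` C)"
      unfolding Int[symmetric] using dec sets
      by (intro Lim_emeasure_decseq) (auto simp: N.emeasure_eq_measure)
    ultimately show ?thesis
      using le[OF G(1)] by (intro LIMSEQ_le) auto
  qed
  show ?thesis
  proof (rule measure_eqI_generator_eq[OF Int_stable_cemetery_generator cemetery_generator_subset])
    fix B assume "B \<in> cemetery_generator D"
    then consider "B = ?T" | U where "openin D U" "B = Some ` U"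
      by (auto simp: cemetery_generator_def)
    then show "emeasure next_law B = emeasure ?N B"
    proof cases
      case 1
      then show ?thesis
        using space N_space by simp
    next
      case 2
      have U: "U \<in> sets (borel_sets_of D)" "topspace D - U \<in> sets (borel_sets_of D)"
        using 2(1) by (auto intro: sets_borel_sets_ofI)
      have split: "Some ` topspace D = Some ` U \<union> Some ` (topspace D - U)" "Some ` U \<inter> Some ` (topspace D - U) = {}"
        using openin_subset[OF 2(1)] by auto
      \<comment> \<open>Two finite sums agree while each term on the left is at most its
        counterpart, so the terms agree.\<close>
      have "emeasure next_law (Some ` U) + emeasure next_law (Some ` (topspace D - U)) =
          emeasure ?N (Some ` U) + emeasure ?N (Some ` (topspace D - U))"
        using total emeasure_distr_Some[OF topspace_borel] U split(2)
        by (subst (1 2) plus_emeasure) (auto simp: image_Some_state_algebra simp flip: split(1))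
      moreover have "emeasure next_law (Some ` (topspace D - U)) \<le> emeasure ?N (Some ` (topspace D - U))"
        using 2(1) by (intro closed_le) auto
      ultimately show ?thesis
        using le[OF 2(1)] 2(2) unfolding NL.emeasure_eq_measure N.emeasure_eq_measure
        by (simp flip: ennreal_plus)
    qed
  next
    show "sets next_law = sigma_sets ?T (cemetery_generator D)"
      using sets_state_algebra by (simp only: sets_next_law[OF ne])
    show "sets ?N = sigma_sets ?T (cemetery_generator D)"
      using sets_state_algebra by (simp only: sets_distr)
    show "range (\<lambda>_::nat. ?T) \<subseteq> cemetery_generator D" "(\<Union>i::nat. ?T) = ?T" "emeasure next_law ?T \<noteq> \<infinity>"
      using NL.emeasure_finite by (auto simp: cemetery_generator_def)
  qed
qed

theorem stationary:
  assumes A: "A \<in> sets (borel_sets_of D)"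
  shows "(\<integral>\<^sup>+x. emeasure (survivor_law (Some x)) (Some ` A) \<partial>m) = emeasure m A"
proof (cases "topspace D = {}")
  case True
  then show ?thesis
    using sets_borel_sets_of_subset[OF A] by (simp add: nn_integral_empty)
next
  case False
  then show ?thesis
    using emeasure_next_law[OF False image_Some_state_algebra[OF A]]
    by (simp add: next_law_eq emeasure_distr_Some[OF A])
qed

text \<open>By \<open>stationary\<close> for all of \<open>D\<close>, the nonnegative deficit from 1
  has integral 0 over the finite measure \<open>m\<close>.\<close>

lemma AE_survivor_law_conservative:
  "AE x in m. emeasure (survivor_law (Some x)) (Some ` topspace D) = 1"
proof -
  let ?f = "\<lambda>x. emeasure (survivor_law (Some x)) (Some ` topspace D)"
  have le: "?f x \<le> 1" if "x \<in> space m" for x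
    using measurable_space[OF measurable_survivor_law_Some that]
    by (intro prob_space.measure_le_1) (auto simp: space_prob_algebra)
  have f: "?f \<in> borel_measurable m"
    using measurable_prob_algebraD[OF measurable_survivor_law_Some]
    by (rule measurable_compose) (intro measurable_emeasure_subprob_algebra image_Some_state_algebra topspace_borel)
  have "(\<integral>\<^sup>+x. 1 - ?f x \<partial>m) = (\<integral>\<^sup>+x. 1 \<partial>m) - (\<integral>\<^sup>+x. ?f x \<partial>m)"
    using f le by (intro nn_integral_diff) (auto simp: stationary)
  also have "\<dots> = 0"
    using stationary[OF topspace_borel] by (simp add: emeasure_eq_measure)
  finally have "AE x in m. 1 - ?f x = 0"
    using f by (subst (asm) nn_integral_0_iff_AE) auto
  then show ?thesis
    using AE_space
  proof eventually_elim
    case (elim x)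
    then show ?case
      using le[of x] by (intro antisym) (auto simp: ennreal_minus_eq_0)
  qed
qed

end

section \<open>The chain of survivors\<close>

locale fleming_viot_system = hunt_process D \<Omega> F P X + prob_space N
  for D :: "'a topology" and \<Omega> :: "'w measure" and F P X and N :: "'n measure" +
  fixes \<xi> \<eta> :: "nat \<Rightarrow> 'n \<Rightarrow> 'w" and x :: 'a
  assumes x: "x \<in> topspace D"
    and system: "fleming_viot \<Omega> P X x x N \<xi> \<eta>"
begin

section \<open>The driven system: measurability, initial value and first step\<close>

abbreviation "Z \<equiv> Z_chain X \<xi> \<eta>"

lemma measurable_driver [measurable]: "\<xi> n \<in> N \<rightarrow>\<^sub>M \<Omega>" "\<eta> n \<in> N \<rightarrow>\<^sub>M \<Omega>"
  using system by (simp_all add: fleming_viot_def)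

lemma distr_driver_0: "distr N (\<Omega> \<Otimes>\<^sub>M \<Omega>) (\<lambda>w. (\<xi> 0 w, \<eta> 0 w)) = P (Some x) \<Otimes>\<^sub>M P (Some x)"
  using system by (simp add: fleming_viot_def)

lemma start_in: "Some x \<in> topspace (with_cemetery D)"
  using x by simp

lemma Z_Suc: "Z (Suc n) w = survivor X (\<xi> n w) (\<eta> n w)"
  by (simp add: Z_chain_def)

lemma measurable_branching_time [measurable]: "branching_time X \<xi> \<eta> n \<in> borel_measurable N"
proof (induction n)
  case (Suc n)
  note [measurable] = Suc
  show ?case
    by simp
qed simp

text \<open>Epoch \<open>0\<close> may be empty on a null set; the initial value is then read off a later epoch.\<close>

lemma Z_0: "Z 0 w = (if \<exists>n. 0 < branching_time X \<xi> \<eta> (Suc n) w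
    then X 0 (\<xi> (LEAST n. 0 < branching_time X \<xi> \<eta> (Suc n) w) w) else None)"
  by (simp add: Z_chain_def particles_def Let_def)

lemma measurable_Z [measurable]: "Z n \<in> N \<rightarrow>\<^sub>M state_algebra D"
proof (cases n)
  case 0
  have [measurable]: "(\<lambda>w. None) \<in> N \<rightarrow>\<^sub>M state_algebra D"
    by (rule measurable_const) simp
  have least: "(\<lambda>w. LEAST n. 0 < branching_time X \<xi> \<eta> (Suc n) w) \<in> N \<rightarrow>\<^sub>M count_space UNIV"
    by (intro measurable_Least) measurable
  have [measurable]: "(\<lambda>w. X 0 (\<xi> (LEAST n. 0 < branching_time X \<xi> \<eta> (Suc n) w) w)) \<in> N \<rightarrow>\<^sub>M state_algebra D"
    by (rule measurable_compose_countable[where f = "\<lambda>i w. X 0 (\<xi> i w)", OF _ least])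
      (intro measurable_compose[OF _ measurable_X] measurable_driver)
  show ?thesis
    unfolding 0 Z_0[abs_def] by measurable
next
  case (Suc k)
  show ?thesis
    unfolding Suc Z_Suc[abs_def] by (intro measurable_survivor measurable_driver)
qed

lemma Z_in: "w \<in> space N \<Longrightarrow> Z n w \<in> topspace (with_cemetery D)"
  using measurable_space[OF measurable_Z] by simp

text \<open>Both initial lifetimes are positive almost surely, so epoch 0 contains time 0 and the
  position there is the start of the first copy.\<close>

lemma AE_Z_0: "AE w in N. Z 0 w = Some x"
proof -
  let ?d = "\<lambda>w. (\<xi> 0 w, \<eta> 0 w)" and ?PP = "P (Some x) \<Otimes>\<^sub>M P (Some x)"
  interpret Px: prob_space "P (Some x)"
    using start_in by (rule prob_space_P)
  have fst: "AE p in ?PP. Q (fst p)" if "AE \<omega> in P (Some x). Q \<omega>" for Q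
  proof (rule AE_distrD[OF measurable_fst])
    show "AE \<omega> in distr ?PP (P (Some x)) fst. Q \<omega>"
      using that by (simp only: prob_space.distr_pair_fst[OF Px.prob_space_axioms])
  qed
  have driver: "AE w in N. Q (?d w)" if "AE p in ?PP. Q p" for Q
    using that unfolding distr_driver_0[symmetric] by (rule AE_distrD[rotated]) measurable
  have alive: "AE \<omega> in P (Some x). 0 < lifetime X \<omega>"
    using x by (rule AE_alive_at_start)
  have "AE p in ?PP. 0 < lifetime X (snd p)"
    by (rule AE_P_pair_snd[OF start_in _ alive]) measurable
  from driver[OF fst[OF start[OF start_in]]] driver[OF fst[OF alive]] driver[OF this]
  have "AE w in N. X 0 (\<xi> 0 w) = Some x" "AE w in N. 0 < lifetime X (\<xi> 0 w)"
    "AE w in N. 0 < lifetime X (\<eta> 0 w)"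
    by simp_all
  then show ?thesis
  proof eventually_elim
    case (elim w)
    then have "0 < branching_time X \<xi> \<eta> (Suc 0) w"
      by simp
    then have ex: "\<exists>n. 0 < branching_time X \<xi> \<eta> (Suc n) w"
      and least: "(LEAST n. 0 < branching_time X \<xi> \<eta> (Suc n) w) = 0"
      by (blast, intro Least_equality) auto
    show ?case
      using elim(1) by (simp only: Z_0 if_P[OF ex] least)
  qed
qed

lemma distr_Z_1: "distr N (state_algebra D) (Z 1) = survivor_law (Some x)"
proof -
  have "distr N (state_algebra D) (Z 1) =
      distr (distr N (\<Omega> \<Otimes>\<^sub>M \<Omega>) (\<lambda>w. (\<xi> 0 w, \<eta> 0 w))) (state_algebra D) (\<lambda>p. survivor X (fst p) (snd p))"
    by (subst distr_distr) (simp_all add: comp_def Z_Suc[of 0, abs_def, simplified])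
  then show ?thesis
    by (simp add: survivor_law_def distr_driver_0)
qed

text \<open>If both independent copies live forever, the first branching time is infinite. Hence the
  square of the probability of living forever is 0.\<close>

lemma AE_lifetime_finite:
  assumes "AE w in N. branching_time X \<xi> \<eta> 1 w < \<infinity>"
  shows "AE \<omega> in P (Some x). lifetime X \<omega> < \<infinity>"
proof -
  interpret Px: prob_space "P (Some x)"
    using start_in by (rule prob_space_P)
  define B where "B = {\<omega> \<in> space \<Omega>. lifetime X \<omega> = \<infinity>}"
  have B [measurable]: "B \<in> sets \<Omega>"
    unfolding B_def by measurable
  have "emeasure (P (Some x)) B * emeasure (P (Some x)) B = emeasure (P (Some x) \<Otimes>\<^sub>M P (Some x)) (B \<times> B)"
    using B start_in by (intro Px.emeasure_pair_measure_Times[symmetric]) (simp_all add: sets_P)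
  also have "\<dots> = emeasure N ((\<lambda>w. (\<xi> 0 w, \<eta> 0 w)) -` (B \<times> B) \<inter> space N)"
    unfolding distr_driver_0[symmetric] by (intro emeasure_distr) auto
  also have "(\<lambda>w. (\<xi> 0 w, \<eta> 0 w)) -` (B \<times> B) \<inter> space N =
      {w \<in> space N. \<xi> 0 w \<in> B \<and> \<eta> 0 w \<in> B}"
    by auto
  also have "emeasure N \<dots> = 0"
    by (rule emeasure_eq_0_AE) (use assms in \<open>auto simp: B_def elim!: eventually_mono\<close>)
  finally have "emeasure (P (Some x)) B = 0"
    by simp
  then have "B \<in> null_sets (P (Some x))"
    using B start_in by (auto simp: sets_P)
  from AE_not_in[OF this] AE_space show ?thesis
    by eventually_elim (use start_in in \<open>auto simp: B_def space_P less_top\<close>)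
qed

section \<open>The Markov property, first for the driving pairs and then for the chain\<close>

abbreviation "driver_past \<equiv> past N (\<Omega> \<Otimes>\<^sub>M \<Omega>) (\<lambda>i w. (\<xi> i w, \<eta> i w))"

lemma subalgebra_past:
  assumes "\<And>i. U i \<in> N \<rightarrow>\<^sub>M S"
  shows "subalgebra N (past N S U n)"
proof -
  have U: "(\<lambda>w. \<lambda>i\<in>{..n}. U i w) \<in> N \<rightarrow>\<^sub>M PiM {..n} (\<lambda>_. S)"
    using assms by (intro measurable_restrict) auto
  have "(\<lambda>w. \<lambda>i\<in>{..n}. U i w) \<in> space N \<rightarrow> space (PiM {..n} (\<lambda>_. S))"
    by (intro Pi_I measurable_space[OF U])
  then have "sets (past N S U n) \<subseteq> sets N"
    unfolding past_def by (subst sets_vimage_algebra2) (auto intro: measurable_sets[OF U])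
  then show ?thesis
    by (simp add: subalgebra_def past_def)
qed

lemma measurable_past:
  assumes "\<And>i. U i \<in> N \<rightarrow>\<^sub>M S" "i \<le> n"
  shows "U i \<in> past N S U n \<rightarrow>\<^sub>M S"
proof -
  have U: "(\<lambda>w. \<lambda>i\<in>{..n}. U i w) \<in> N \<rightarrow>\<^sub>M PiM {..n} (\<lambda>_. S)"
    using assms(1) by (intro measurable_restrict) auto
  have "(\<lambda>w. \<lambda>i\<in>{..n}. U i w) \<in> past N S U n \<rightarrow>\<^sub>M PiM {..n} (\<lambda>_. S)"
    unfolding past_def by (intro measurable_vimage_algebra1 Pi_I measurable_space[OF U])
  then have "(\<lambda>w. (\<lambda>i\<in>{..n}. U i w) i) \<in> past N S U n \<rightarrow>\<^sub>M S"
    by (rule measurable_compose) (use assms(2) in \<open>auto intro: measurable_component_singleton\<close>)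
  then show ?thesis
    using assms(2) by simp
qed

lemma measurable_P_Z: "(\<lambda>w. P (Z n w)) \<in> N \<rightarrow>\<^sub>M prob_algebra \<Omega>"
  using measurable_Z kernel by (rule measurable_compose)

lemma measurable_survivor_law_Z: "(\<lambda>w. survivor_law (Z n w)) \<in> N \<rightarrow>\<^sub>M prob_algebra (state_algebra D)"
  using measurable_Z measurable_survivor_law by (rule measurable_compose)

lemma measurable_driver_pair [measurable]: "(\<lambda>w. (\<xi> i w, \<eta> i w)) \<in> N \<rightarrow>\<^sub>M \<Omega> \<Otimes>\<^sub>M \<Omega>"
  by measurable

text \<open>The conditional probability in \<open>fleming_viot\<close>, integrated over an event of
  the past; the product of the two one-particle probabilities is the pair law of the
  rectangle.\<close>

lemma driver_step_rectangle:
  assumes H: "H \<in> sets (driver_past n)" and B: "B \<in> sets \<Omega>" and C: "C \<in> sets \<Omega>"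
  shows "emeasure N (H \<inter> {w \<in> space N. \<xi> (Suc n) w \<in> B \<and> \<eta> (Suc n) w \<in> C}) =
    (\<integral>\<^sup>+w. indicator H w * emeasure (P (Z (Suc n) w) \<Otimes>\<^sub>M P (Z (Suc n) w)) (B \<times> C) \<partial>N)"
proof -
  let ?E = "{w \<in> space N. \<xi> (Suc n) w \<in> B \<and> \<eta> (Suc n) w \<in> C}"
  let ?g = "\<lambda>w. measure (P (Z (Suc n) w)) B * measure (P (Z (Suc n) w)) C"
  interpret G: finite_measure_subalgebra N "driver_past n"
    by standard (rule subalgebra_past, rule measurable_driver_pair)
  have [measurable]: "B \<in> sets \<Omega>" "C \<in> sets \<Omega>" "H \<in> sets N"
    using B C H G.subalg by (auto simp: subalgebra_def)
  have E: "?E \<in> sets N"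
    by measurable
  have g [measurable]: "?g \<in> borel_measurable N"
    by (intro borel_measurable_times measurable_compose[OF measurable_P_Z measurable_measure_prob_algebra] B C)
  have "AE w in N. cond_prob_given N (driver_past n) ?E w = ?g w"
    using system B C unfolding fleming_viot_def by blast
  then have "(\<integral>w\<in>H. cond_prob_given N (driver_past n) ?E w \<partial>N) = (\<integral>w\<in>H. ?g w \<partial>N)"
    by (intro set_lebesgue_integral_cong_AE) (auto intro: borel_measurable_cond_exp2)
  moreover have "(\<integral>w\<in>H. indicator ?E w \<partial>N) = (\<integral>w\<in>H. cond_prob_given N (driver_past n) ?E w \<partial>N)"
    using E by (intro G.real_cond_exp_intA H integrable_real_indicator) (auto simp: emeasure_eq_measure)
  moreover have "(\<integral>w\<in>H. indicator ?E w \<partial>N) = measure N (H \<inter> ?E)"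
  proof -
    have "(\<integral>w\<in>H. indicator ?E w \<partial>N) = (\<integral>w. indicator (H \<inter> ?E) w \<partial>N)"
      unfolding set_lebesgue_integral_def
      by (intro Bochner_Integration.integral_cong) (auto simp: indicator_def)
    also have "\<dots> = measure N (H \<inter> ?E)"
      by (simp add: Int_assoc)
    finally show ?thesis .
  qed
  ultimately have "emeasure N (H \<inter> ?E) = ennreal (\<integral>w. indicator H w * ?g w \<partial>N)"
    by (simp add: emeasure_eq_measure set_lebesgue_integral_def)
  also have "\<dots> = (\<integral>\<^sup>+w. ennreal (indicator H w * ?g w) \<partial>N)"
  proof (rule nn_integral_eq_integral[symmetric])
    show "integrable N (\<lambda>w. indicator H w * ?g w)"
    proof (rule integrable_const_bound[where B = 1])
      show "AE w in N. norm (indicator H w * ?g w) \<le> 1"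
      proof (rule AE_I2)
        fix w assume "w \<in> space N"
        then interpret PZ: prob_space "P (Z (Suc n) w)"
          by (intro prob_space_P Z_in)
        show "norm (indicator H w * ?g w) \<le> 1"
          by (auto simp: indicator_def intro!: mult_le_one)
      qed
    qed measurable
  qed (auto intro!: AE_I2)
  also have "\<dots> = (\<integral>\<^sup>+w. indicator H w * emeasure (P (Z (Suc n) w) \<Otimes>\<^sub>M P (Z (Suc n) w)) (B \<times> C) \<partial>N)"
  proof (rule nn_integral_cong)
    fix w assume "w \<in> space N"
    then have z: "Z (Suc n) w \<in> topspace (with_cemetery D)"
      by (rule Z_in)
    interpret PZ: prob_space "P (Z (Suc n) w)"
      using z by (rule prob_space_P)
    have "emeasure (P (Z (Suc n) w) \<Otimes>\<^sub>M P (Z (Suc n) w)) (B \<times> C) = ennreal (?g w)"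
      using z B C by (simp add: PZ.emeasure_pair_measure_Times sets_P PZ.emeasure_eq_measure ennreal_mult')
    then show "ennreal (indicator H w * ?g w) =
        indicator H w * emeasure (P (Z (Suc n) w) \<Otimes>\<^sub>M P (Z (Suc n) w)) (B \<times> C)"
      by (simp add: indicator_def)
  qed
  finally show ?thesis .
qed

text \<open>As functions of \<open>E\<close> both sides are finite measures, and they agree on the
  intersection-stable rectangles.\<close>

lemma driver_step:
  assumes H: "H \<in> sets (driver_past n)" and E: "E \<in> sets (\<Omega> \<Otimes>\<^sub>M \<Omega>)"
  shows "(\<integral>\<^sup>+w. indicator H w * indicator E (\<xi> (Suc n) w, \<eta> (Suc n) w) \<partial>N) =
    (\<integral>\<^sup>+w. indicator H w * emeasure (P (Z (Suc n) w) \<Otimes>\<^sub>M P (Z (Suc n) w)) E \<partial>N)"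
proof -
  let ?d = "\<lambda>w. (\<xi> (Suc n) w, \<eta> (Suc n) w)" and ?Q = "\<lambda>w. P (Z (Suc n) w) \<Otimes>\<^sub>M P (Z (Suc n) w)"
  let ?H = "density N (indicator H)"
  let ?M1 = "distr ?H (\<Omega> \<Otimes>\<^sub>M \<Omega>) ?d" and ?M2 = "?H \<bind> ?Q"
  let ?G = "{B \<times> C |B C. B \<in> sets \<Omega> \<and> C \<in> sets \<Omega>}"
  have [measurable]: "H \<in> sets N"
    using H subalgebra_past[of "\<lambda>i w. (\<xi> i w, \<eta> i w)", OF measurable_driver_pair] by (auto simp: subalgebra_def)
  have Q: "?Q \<in> N \<rightarrow>\<^sub>M subprob_algebra (\<Omega> \<Otimes>\<^sub>M \<Omega>)"
    by (intro measurable_prob_algebraD measurable_pair_prob measurable_P_Z)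
  then have Q': "?Q \<in> ?H \<rightarrow>\<^sub>M subprob_algebra (\<Omega> \<Otimes>\<^sub>M \<Omega>)"
    by simp
  have em1: "emeasure ?M1 A = (\<integral>\<^sup>+w. indicator H w * indicator A (?d w) \<partial>N)"
    if [measurable]: "A \<in> sets (\<Omega> \<Otimes>\<^sub>M \<Omega>)" for A
  proof -
    have "emeasure ?M1 A = emeasure ?H (?d -` A \<inter> space N)"
      by (subst emeasure_distr) auto
    also have "\<dots> = (\<integral>\<^sup>+w. indicator H w * indicator (?d -` A \<inter> space N) w \<partial>N)"
      by (intro emeasure_density measurable_sets[OF measurable_driver_pair that]) auto
    also have "\<dots> = (\<integral>\<^sup>+w. indicator H w * indicator A (?d w) \<partial>N)"
      by (intro nn_integral_cong) (simp add: indicator_def)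
    finally show ?thesis .
  qed
  have em2: "emeasure ?M2 A = (\<integral>\<^sup>+w. indicator H w * emeasure (?Q w) A \<partial>N)"
    if A: "A \<in> sets (\<Omega> \<Otimes>\<^sub>M \<Omega>)" for A
  proof -
    have "emeasure ?M2 A = (\<integral>\<^sup>+w. emeasure (?Q w) A \<partial>?H)"
      using not_empty by (intro emeasure_bind[OF _ Q' A]) simp
    also have "\<dots> = (\<integral>\<^sup>+w. indicator H w * emeasure (?Q w) A \<partial>N)"
      by (intro nn_integral_density measurable_compose[OF Q measurable_emeasure_subprob_algebra[OF A]]) auto
    finally show ?thesis .
  qed
  have "?M1 = ?M2"
  proof (rule measure_eqI_generator_eq[OF Int_stable_pair_measure_generator pair_measure_closed])
    fix A assume "A \<in> ?G"
    then obtain B C where BC: "B \<in> sets \<Omega>" "C \<in> sets \<Omega>" and A: "A = B \<times> C"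
      by blast
    have sets: "B \<times> C \<in> sets (\<Omega> \<Otimes>\<^sub>M \<Omega>)"
      using BC by (rule pair_measureI)
    let ?E = "{w \<in> space N. \<xi> (Suc n) w \<in> B \<and> \<eta> (Suc n) w \<in> C}"
    have "H \<inter> ?E \<in> sets N"
      using BC by measurable
    then have "emeasure N (H \<inter> ?E) = (\<integral>\<^sup>+w. indicator (H \<inter> ?E) w \<partial>N)"
      by (rule nn_integral_indicator[symmetric])
    also have "\<dots> = (\<integral>\<^sup>+w. indicator H w * indicator (B \<times> C) (?d w) \<partial>N)"
      by (intro nn_integral_cong) (simp add: indicator_def)
    finally have "(\<integral>\<^sup>+w. indicator H w * indicator (B \<times> C) (?d w) \<partial>N) = emeasure N (H \<inter> ?E)" ..
    then show "emeasure ?M1 A = emeasure ?M2 A"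
      unfolding A em1[OF sets] em2[OF sets] using driver_step_rectangle[OF H BC] by simp
  next
    show "sets ?M1 = sigma_sets (space \<Omega> \<times> space \<Omega>) ?G"
      by (simp add: sets_pair_measure)
    have "sets ?M2 = sets (\<Omega> \<Otimes>\<^sub>M \<Omega>)"
      using not_empty by (intro sets_bind sets_kernel[OF Q']) simp_all
    then show "sets ?M2 = sigma_sets (space \<Omega> \<times> space \<Omega>) ?G"
      by (simp only: sets_pair_measure)
    show "range (\<lambda>_::nat. space \<Omega> \<times> space \<Omega>) \<subseteq> ?G" "(\<Union>i::nat. space \<Omega> \<times> space \<Omega>) = space \<Omega> \<times> space \<Omega>"
      by auto
    have "emeasure ?M1 (space \<Omega> \<times> space \<Omega>) =
        (\<integral>\<^sup>+w. indicator H w * indicator (space \<Omega> \<times> space \<Omega>) (?d w) \<partial>N)"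
      by (intro em1 pair_measureI) simp_all
    also have "\<dots> \<le> (\<integral>\<^sup>+w. 1 \<partial>N)"
      by (intro nn_integral_mono) (simp add: indicator_def)
    finally show "emeasure ?M1 (space \<Omega> \<times> space \<Omega>) \<noteq> \<infinity>"
      by (auto simp: emeasure_space_1 top_unique)
  qed
  then show ?thesis
    using em1[OF E] em2[OF E] by simp
qed

text \<open>This is \<open>driver_step\<close> for the preimage of \<open>A\<close> under the
  survivor map. Pair n+1 starts at \<open>Z (Suc n)\<close> and its survivor is
  \<open>Z (Suc (Suc n))\<close>, which explains the shift.\<close>

lemma survivor_step:
  assumes H: "H \<in> sets (driver_past n)" and A: "A \<in> sets (state_algebra D)"
  shows "(\<integral>\<^sup>+w. indicator H w * indicator A (Z (Suc (Suc n)) w) \<partial>N) =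
    (\<integral>\<^sup>+w. indicator H w * emeasure (survivor_law (Z (Suc n) w)) A \<partial>N)"
proof -
  let ?s = "\<lambda>p. survivor X (fst p) (snd p)"
  have s: "?s \<in> \<Omega> \<Otimes>\<^sub>M \<Omega> \<rightarrow>\<^sub>M state_algebra D"
    by (intro measurable_survivor measurable_fst measurable_snd)
  define E where "E = ?s -` A \<inter> space (\<Omega> \<Otimes>\<^sub>M \<Omega>)"
  have E: "E \<in> sets (\<Omega> \<Otimes>\<^sub>M \<Omega>)"
    unfolding E_def using s A by (rule measurable_sets)
  have "(\<integral>\<^sup>+w. indicator H w * indicator A (Z (Suc (Suc n)) w) \<partial>N) =
      (\<integral>\<^sup>+w. indicator H w * indicator E (\<xi> (Suc n) w, \<eta> (Suc n) w) \<partial>N)"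
    using measurable_space[OF measurable_driver_pair]
    by (intro nn_integral_cong) (auto simp: indicator_def E_def Z_Suc)
  also have "\<dots> = (\<integral>\<^sup>+w. indicator H w * emeasure (P (Z (Suc n) w) \<Otimes>\<^sub>M P (Z (Suc n) w)) E \<partial>N)"
    by (rule driver_step[OF H E])
  also have "\<dots> = (\<integral>\<^sup>+w. indicator H w * emeasure (survivor_law (Z (Suc n) w)) A \<partial>N)"
  proof (rule nn_integral_cong)
    fix w assume "w \<in> space N"
    then have z: "Z (Suc n) w \<in> topspace (with_cemetery D)"
      by (rule Z_in)
    have "space (P (Z (Suc n) w) \<Otimes>\<^sub>M P (Z (Suc n) w)) = space (\<Omega> \<Otimes>\<^sub>M \<Omega>)"
      using sets_P_pair[OF z] by (rule sets_eq_imp_space_eq)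
    then have "emeasure (survivor_law (Z (Suc n) w)) A = emeasure (P (Z (Suc n) w) \<Otimes>\<^sub>M P (Z (Suc n) w)) E"
      unfolding survivor_law_def E_def using s A
      by (subst emeasure_distr) (simp_all add: measurable_cong_sets[OF sets_P_pair[OF z]])
    then show "indicator H w * emeasure (P (Z (Suc n) w) \<Otimes>\<^sub>M P (Z (Suc n) w)) E =
        indicator H w * emeasure (survivor_law (Z (Suc n) w)) A"
      by simp
  qed
  finally show ?thesis .
qed

text \<open>
  Up to a null set \<open>Z 0\<close> is the constant \<open>Some x\<close>, and with this change \<open>Z 0, \<dots>, Z (n + 1)\<close> are
  functions of the first \<open>n + 1\<close> pairs of driving elements.
\<close>

lemma Z_step:
  assumes H: "H \<in> sets (PiM {..n} (\<lambda>_. state_algebra D))" and A: "A \<in> sets (state_algebra D)"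
  shows "(\<integral>\<^sup>+w. indicator H (\<lambda>i\<in>{..n}. Z i w) * indicator A (Z (Suc n) w) \<partial>N) =
    (\<integral>\<^sup>+w. indicator H (\<lambda>i\<in>{..n}. Z i w) * emeasure (survivor_law (Z n w)) A \<partial>N)"
proof -
  define Z' where "Z' i w = (if i = 0 then Some x else Z i w)" for i w
  let ?H = "{w \<in> space N. (\<lambda>i\<in>{..n}. Z' i w) \<in> H}"
  have "AE w in N. \<forall>i. Z i w = Z' i w"
    using AE_Z_0 by eventually_elim (auto simp: Z'_def)
  then have eq: "AE w in N. (\<lambda>i\<in>{..n}. Z i w) = (\<lambda>i\<in>{..n}. Z' i w)" "AE w in N. Z n w = Z' n w"
    by (eventually_elim, simp)+
  have "(\<integral>\<^sup>+w. indicator ?H w * indicator A (Z (Suc n) w) \<partial>N) =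
      (\<integral>\<^sup>+w. indicator ?H w * emeasure (survivor_law (Z' n w)) A \<partial>N)"
  \<comment> \<open>No driving pair precedes the first step. There the history is the constant
    start, and the law of \<open>Z 1\<close> comes from the initial distribution of the
    drivers.\<close>
  proof (cases n)
    case 0
    let ?c = "indicator H (\<lambda>i\<in>{..n}. Some x) :: ennreal"
    have c: "indicator ?H w = ?c" if "w \<in> space N" for w
    proof -
      have "(\<lambda>i\<in>{..n}. Z' i w) = (\<lambda>i\<in>{..n}. Some x)"
        using 0 by (auto simp: Z'_def restrict_def)
      then show ?thesis
        using that by (simp add: indicator_def)
    qed
    have "(\<integral>\<^sup>+w. indicator ?H w * indicator A (Z (Suc n) w) \<partial>N) =
        (\<integral>\<^sup>+w. ?c * indicator (Z 1 -` A \<inter> space N) w \<partial>N)"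
    proof (rule nn_integral_cong)
      fix w assume w: "w \<in> space N"
      have "indicator A (Z (Suc n) w) = (indicator (Z 1 -` A \<inter> space N) w :: ennreal)"
        using 0 w by (simp add: indicator_def)
      then show "indicator ?H w * indicator A (Z (Suc n) w) = ?c * indicator (Z 1 -` A \<inter> space N) w"
        by (simp only: c[OF w])
    qed
    also have "\<dots> = ?c * emeasure N (Z 1 -` A \<inter> space N)"
      using measurable_sets[OF measurable_Z A] by (intro nn_integral_cmult_indicator)
    also have "\<dots> = ?c * emeasure (survivor_law (Some x)) A"
      unfolding distr_Z_1[symmetric] using A by (simp add: emeasure_distr)
    also have "\<dots> = (\<integral>\<^sup>+w. ?c * emeasure (survivor_law (Some x)) A \<partial>N)"
      by (simp add: emeasure_space_1)
    also have "\<dots> = (\<integral>\<^sup>+w. indicator ?H w * emeasure (survivor_law (Z' n w)) A \<partial>N)"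
    proof (rule nn_integral_cong)
      fix w assume "w \<in> space N"
      moreover have "Z' n w = Some x"
        using 0 by (simp add: Z'_def)
      ultimately show "?c * emeasure (survivor_law (Some x)) A = indicator ?H w * emeasure (survivor_law (Z' n w)) A"
        by (simp only: c)
    qed
    finally show ?thesis .
  next
    case (Suc k)
    have "?H \<in> sets (driver_past k)"
    proof -
      have "Z' i \<in> driver_past k \<rightarrow>\<^sub>M state_algebra D" if "i \<le> n" for i
      proof (cases i)
        case 0
        then show ?thesis
          using x by (simp add: Z'_def[abs_def])
      next
        case (Suc l)
        then have "(\<lambda>w. (\<xi> l w, \<eta> l w)) \<in> driver_past k \<rightarrow>\<^sub>M \<Omega> \<Otimes>\<^sub>M \<Omega>"
          using that \<open>n = Suc k\<close> by (intro measurable_past[OF measurable_driver_pair]) simp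
        then have "\<xi> l \<in> driver_past k \<rightarrow>\<^sub>M \<Omega>" "\<eta> l \<in> driver_past k \<rightarrow>\<^sub>M \<Omega>"
          using measurable_compose[OF _ measurable_fst] measurable_compose[OF _ measurable_snd]
          by force+
        then show ?thesis
          unfolding Z'_def[abs_def] Suc by (simp add: Z_Suc[abs_def] measurable_survivor)
      qed
      then have "(\<lambda>w. \<lambda>i\<in>{..n}. Z' i w) \<in> driver_past k \<rightarrow>\<^sub>M PiM {..n} (\<lambda>_. state_algebra D)"
        by (intro measurable_restrict) simp
      from measurable_sets[OF this H] show ?thesis
        by (simp add: past_def vimage_def Int_def conj_commute)
    qed
    from survivor_step[OF this A] Suc show ?thesis
      by (simp add: Z'_def)
  qed
  moreover have "(\<integral>\<^sup>+w. indicator H (\<lambda>i\<in>{..n}. Z i w) * f w \<partial>N) = (\<integral>\<^sup>+w. indicator ?H w * f w \<partial>N)" for f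
    using eq(1) AE_space by (intro nn_integral_cong_AE, eventually_elim) (simp add: indicator_def)
  moreover have "(\<integral>\<^sup>+w. indicator ?H w * emeasure (survivor_law (Z n w)) A \<partial>N) =
      (\<integral>\<^sup>+w. indicator ?H w * emeasure (survivor_law (Z' n w)) A \<partial>N)"
    using eq(2) by (intro nn_integral_cong_AE, eventually_elim) simp
  ultimately show ?thesis
    by simp
qed

lemma emeasure_Z_Suc:
  assumes A: "A \<in> sets (state_algebra D)"
  shows "emeasure N {w \<in> space N. Z (Suc n) w \<in> A} = (\<integral>\<^sup>+w. emeasure (survivor_law (Z n w)) A \<partial>N)"
proof -
  let ?T = "PiM {..n} (\<lambda>_. state_algebra D)"
  have "{w \<in> space N. Z (Suc n) w \<in> A} \<in> sets N"
    using A by measurable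
  then have "emeasure N {w \<in> space N. Z (Suc n) w \<in> A} =
      (\<integral>\<^sup>+w. indicator {w \<in> space N. Z (Suc n) w \<in> A} w \<partial>N)"
    by (rule nn_integral_indicator[symmetric])
  also have "\<dots> = (\<integral>\<^sup>+w. indicator A (Z (Suc n) w) \<partial>N)"
    by (intro nn_integral_cong) (simp add: indicator_def)
  finally have "emeasure N {w \<in> space N. Z (Suc n) w \<in> A} = (\<integral>\<^sup>+w. indicator A (Z (Suc n) w) \<partial>N)" .
  moreover have "(\<lambda>i\<in>{..n}. Z i w) \<in> space ?T" if "w \<in> space N" for w
    using Z_in[OF that] by (simp add: space_PiM)
  then have "(\<integral>\<^sup>+w. indicator (space ?T) (\<lambda>i\<in>{..n}. Z i w) * f w \<partial>N) = (\<integral>\<^sup>+w. f w \<partial>N)" for f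
    by (intro nn_integral_cong) simp
  ultimately show ?thesis
    using Z_step[OF sets.top A, of n] by simp
qed

text \<open>Events of the past are preimages of measurable sets of histories, for which
  \<open>Z_step\<close> supplies the defining integral identity of the conditional
  expectation.\<close>

lemma cond_prob_Z:
  assumes A: "A \<in> sets (state_algebra D)"
  shows "AE w in N. cond_prob_given N (past N (state_algebra D) Z n) {w \<in> space N. Z (Suc n) w \<in> A} w
    = measure (survivor_law (Z n w)) A"
proof -
  let ?E = "{w \<in> space N. Z (Suc n) w \<in> A}" and ?g = "\<lambda>w. measure (survivor_law (Z n w)) A"
  let ?past = "past N (state_algebra D) Z n"
  interpret G: finite_measure_subalgebra N ?past
    by standard (rule subalgebra_past, rule measurable_Z)
  have E [measurable]: "?E \<in> sets N"
    using A by measurable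
  have g: "?g \<in> borel_measurable ?past"
    using A by (intro measurable_compose[OF measurable_compose[OF measurable_past[OF measurable_Z] measurable_survivor_law]
          measurable_measure_prob_algebra]) simp_all
  then have gN [measurable]: "?g \<in> borel_measurable N"
    by (rule measurable_from_subalg[OF G.subalg])
  have law: "prob_space (survivor_law (Z n w))" if "w \<in> space N" for w
    using measurable_space[OF measurable_survivor_law_Z that] by (simp add: space_prob_algebra)
  show ?thesis
  proof (rule G.real_cond_exp_charact)
    fix H assume H: "H \<in> sets ?past"
    then have [measurable]: "H \<in> sets N"
      using G.subalg by (auto simp: subalgebra_def)
    have "(\<lambda>w. \<lambda>i\<in>{..n}. Z i w) \<in> space N \<rightarrow> space (PiM {..n} (\<lambda>_. state_algebra D))"
      using Z_in by (auto simp: space_PiM)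
    with H obtain H' where H': "H' \<in> sets (PiM {..n} (\<lambda>_. state_algebra D))"
      "H = (\<lambda>w. \<lambda>i\<in>{..n}. Z i w) -` H' \<inter> space N"
      unfolding past_def by (auto simp: sets_vimage_algebra2)
    have ind: "indicator H w = (indicator H' (\<lambda>i\<in>{..n}. Z i w) :: ennreal)" if "w \<in> space N" for w
      using that by (simp add: H'(2) indicator_def)
    have "(\<integral>w\<in>H. indicator ?E w \<partial>N) = enn2real (\<integral>\<^sup>+w. ennreal (indicator H w * indicator ?E w) \<partial>N)"
      unfolding set_lebesgue_integral_def real_scaleR_def by (rule integral_eq_nn_integral) auto
    also have "(\<integral>\<^sup>+w. ennreal (indicator H w * indicator ?E w) \<partial>N) =
        (\<integral>\<^sup>+w. indicator H' (\<lambda>i\<in>{..n}. Z i w) * indicator A (Z (Suc n) w) \<partial>N)"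
      by (intro nn_integral_cong, subst ind[symmetric]) (auto simp: indicator_def)
    also have "\<dots> = (\<integral>\<^sup>+w. indicator H' (\<lambda>i\<in>{..n}. Z i w) * emeasure (survivor_law (Z n w)) A \<partial>N)"
      by (rule Z_step[OF H'(1) A])
    also have "\<dots> = (\<integral>\<^sup>+w. ennreal (indicator H w * ?g w) \<partial>N)"
    proof (rule nn_integral_cong)
      fix w assume w: "w \<in> space N"
      then interpret L: prob_space "survivor_law (Z n w)"
        by (rule law)
      show "indicator H' (\<lambda>i\<in>{..n}. Z i w) * emeasure (survivor_law (Z n w)) A = ennreal (indicator H w * ?g w)"
        unfolding ind[OF w, symmetric] by (simp add: L.emeasure_eq_measure indicator_def)
    qed
    also have "enn2real \<dots> = (\<integral>w\<in>H. ?g w \<partial>N)"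
      unfolding set_lebesgue_integral_def real_scaleR_def by (rule integral_eq_nn_integral[symmetric]) auto
    finally show "(\<integral>w\<in>H. indicator ?E w \<partial>N) = (\<integral>w\<in>H. ?g w \<partial>N)" .
  next
    show "integrable N (indicator ?E :: _ \<Rightarrow> real)"
      using E by (intro integrable_real_indicator) (auto simp: emeasure_eq_measure)
    show "integrable N ?g"
      by (rule integrable_const_bound[where B = 1]) (auto intro!: AE_I2 prob_space.prob_le_1 law)
  qed (rule g)
qed

end

section \<open>Conservativeness for almost every start\<close>

context self_dual_hunt_process
begin

text \<open>
  The exceptional set cannot be fixed in advance: a null set is avoided at time \<open>n + 1\<close> if at time
  \<open>n\<close> the chain avoids the null set from which it is charged.
\<close>

lemma AE_Z_avoids_null_set:
  assumes "\<And>x. x \<in> topspace D \<Longrightarrow> fleming_viot \<Omega> P X x x (Pbar x) \<xi> \<eta>"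
    and "B \<in> null_sets m"
  shows "AE x in m. AE w in Pbar x. Z_chain X \<xi> \<eta> n w \<notin> insert None (Some ` B)"
proof -
  have sys: "fleming_viot_system D \<Omega> F P X (Pbar x) \<xi> \<eta> x" if "x \<in> topspace D" for x
    using assms(1)[OF that] that hunt_process_axioms
    by (intro fleming_viot_system.intro fleming_viot_system_axioms.intro) (auto simp: fleming_viot_def)
  show ?thesis
    using assms(2)
  proof (induction n arbitrary: B)
    case 0
    show ?case
      using AE_not_in[OF 0] AE_space
    proof eventually_elim
      case (elim x)
      then interpret fleming_viot_system D \<Omega> F P X "Pbar x" \<xi> \<eta> x
        by (intro sys) simp
      show ?case
        using AE_Z_0 by eventually_elim (use elim in auto)
    qed
  next
    case (Suc n)
    let ?A = "insert None (Some ` B)" and ?law = "\<lambda>x. survivor_law (Some x)"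
    have B: "B \<in> sets (borel_sets_of D)"
      using Suc.prems sets_m by auto
    have SB: "Some ` B \<in> sets (state_algebra D)"
      using B by (rule image_Some_state_algebra)
    have A: "?A \<in> sets (state_algebra D)"
      using sets.Un[OF singleton_None_state_algebra SB] by simp
    have em: "(\<lambda>x. emeasure (?law x) C) \<in> borel_measurable m" if "C \<in> sets (state_algebra D)" for C
      using measurable_prob_algebraD[OF measurable_survivor_law_Some] that
      by (rule measurable_compose[OF _ measurable_emeasure_subprob_algebra])
    \<comment> \<open>Stationarity: a null set is charged only from a null set of starting
      points.\<close>
    have "(\<integral>\<^sup>+x. emeasure (?law x) (Some ` B) \<partial>m) = 0"
      using stationary[OF B] null_setsD1[OF Suc.prems] by simp
    then have "AE x in m. emeasure (?law x) (Some ` B) = 0"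
      by (rule iffD1[OF nn_integral_0_iff_AE[OF em[OF SB]]])
    with AE_survivor_law_conservative AE_space
    have "AE x in m. emeasure (?law x) ?A = 0"
    proof eventually_elim
      case (elim x)
      then have law: "prob_space (?law x)" "sets (?law x) = sets (state_algebra D)"
        using measurable_space[OF measurable_survivor_law_Some elim(2)] by (auto simp: space_prob_algebra)
      then interpret L: prob_space "?law x"
        by simp
      have "emeasure (?law x) {None} = emeasure (?law x) (space (?law x) - Some ` topspace D)"
        using sets_eq_imp_space_eq[OF law(2)] by (intro arg_cong[where f = "emeasure (?law x)"]) auto
      also have "\<dots> = 0"
        using elim(1) law(2) image_Some_state_algebra[OF topspace_borel]
        by (subst emeasure_compl) (auto simp: L.emeasure_space_1)
      finally show ?case
        using emeasure_subadditive[of "{None}" "?law x" "Some ` B"] elim(3) law(2) SB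
          singleton_None_state_algebra[of D]
        by simp
    qed
    moreover note [measurable] = em[OF A]
    have "{x \<in> space m. emeasure (?law x) ?A \<noteq> 0} \<in> sets m"
      by measurable
    ultimately have "{x \<in> space m. emeasure (?law x) ?A \<noteq> 0} \<in> null_sets m"
      by (simp only: AE_iff_null)
    \<comment> \<open>The induction hypothesis is used for a new null set: the points from which one
      step hits the cemetery or \<open>B\<close> with positive probability.\<close>
    from Suc.IH[OF this] AE_space show ?case
    proof eventually_elim
      case (elim x)
      then interpret fleming_viot_system D \<Omega> F P X "Pbar x" \<xi> \<eta> x
        by (intro sys) simp
      have "AE w in Pbar x. emeasure (survivor_law (Z n w)) ?A = 0"
        using elim(1) AE_space
      proof eventually_elim
        case (elim w)
        then show ?case
          using Z_in[OF elim(2), of n] by auto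
      qed
      then have "emeasure (Pbar x) {w \<in> space (Pbar x). Z (Suc n) w \<in> ?A} = 0"
        unfolding emeasure_Z_Suc[OF A]
        by (subst nn_integral_0_iff_AE)
          (auto intro!: measurable_compose[OF measurable_prob_algebraD[OF measurable_survivor_law_Z]]
            measurable_emeasure_subprob_algebra A)
      then have "{w \<in> space (Pbar x). Z (Suc n) w \<in> ?A} \<in> null_sets (Pbar x)"
        using measurable_sets[OF measurable_Z A] by (auto simp: vimage_def Int_def conj_commute)
      from AE_not_in[OF this] AE_space show ?case
        by eventually_elim auto
    qed
  qed
qed

end

theorem corollary1p6:
  fixes D :: "'a topology"
    and \<Omega> :: "'w measure"
    and F :: "ennreal \<Rightarrow> 'w measure"
    and P :: "'a option \<Rightarrow> 'w measure"
    and X :: "ennreal \<Rightarrow> 'w \<Rightarrow> 'a option"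
    and m :: "'a measure"
    and Pbar :: "'a \<Rightarrow> 'n measure"
    and \<xi> \<eta> :: "nat \<Rightarrow> 'n \<Rightarrow> 'w"
  assumes "hunt_process D \<Omega> F P X"
    and "finite_measure m"
    and "self_dual D P X m"
    and "\<And>x. x \<in> topspace D \<Longrightarrow> fleming_viot \<Omega> P X x x (Pbar x) \<xi> \<eta>"
    and "AE x in m. AE w in Pbar x. \<forall>n. branching_time X \<xi> \<eta> n w < \<infinity>"
  shows "(\<forall>x\<in>topspace D.
            (AE w in Pbar x. Z_chain X \<xi> \<eta> 0 w = Some x) \<and>
            markov_chain (Pbar x) (state_algebra D) (Z_kernel D X Pbar \<xi> \<eta>) (Z_chain X \<xi> \<eta>))
       \<and> (AE x in m. AE w in Pbar x. \<forall>n. Z_chain X \<xi> \<eta> n w \<in> Some ` topspace D)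
       \<and> (\<forall>A\<in>sets (borel_sets_of D).
            (\<integral>\<^sup>+x. emeasure (Pbar x) {w \<in> space (Pbar x). Z_chain X \<xi> \<eta> 1 w \<in> Some ` A} \<partial>m)
              = emeasure m A)"
proof -
  interpret hunt_process D \<Omega> F P X
    by fact
  have sys: "fleming_viot_system D \<Omega> F P X (Pbar x) \<xi> \<eta> x" if "x \<in> topspace D" for x
    using assms(4)[OF that] that assms(1)
    by (intro fleming_viot_system.intro fleming_viot_system_axioms.intro) (auto simp: fleming_viot_def)
  have space_m: "space m = topspace D"
    using assms(3) sets_eq_imp_space_eq[of m "borel_sets_of D"] by (simp add: self_dual_def)
  have "AE x in m. AE \<omega> in P (Some x). lifetime X \<omega> < \<infinity>"
    using assms(5) AE_space
  proof eventually_elim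
    case (elim x)
    then interpret fleming_viot_system D \<Omega> F P X "Pbar x" \<xi> \<eta> x
      by (intro sys) (simp add: space_m)
    show ?case
      by (rule AE_lifetime_finite, rule eventually_mono[OF elim(1)]) blast
  qed
  then interpret S: self_dual_hunt_process D \<Omega> F P X m
    using assms(1-3) by (intro self_dual_hunt_process.intro self_dual_hunt_process_axioms.intro)
  \<comment> \<open>The law of \<open>Z 1\<close> is the same for every system realising the start.
    As \<open>Pbar\<close> is an arbitrary choice for each start, measurability of
    \<open>Z_kernel\<close> is obtained through this identity.\<close>
  have kernel: "Z_kernel D X Pbar \<xi> \<eta> z = survivor_law z" if "z \<in> topspace (with_cemetery D)" for z
    using that fleming_viot_system.distr_Z_1[OF sys]
    by (auto simp: Z_kernel_def survivor_law_None)
  have "(AE w in Pbar x. Z_chain X \<xi> \<eta> 0 w = Some x) \<and>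
      markov_chain (Pbar x) (state_algebra D) (Z_kernel D X Pbar \<xi> \<eta>) (Z_chain X \<xi> \<eta>)"
    if "x \<in> topspace D" for x
  proof -
    interpret fleming_viot_system D \<Omega> F P X "Pbar x" \<xi> \<eta> x
      using that by (rule sys)
    have "Z_kernel D X Pbar \<xi> \<eta> \<in> state_algebra D \<rightarrow>\<^sub>M prob_algebra (state_algebra D)"
      using measurable_survivor_law kernel by (subst measurable_cong) auto
    moreover have "AE w in Pbar x. cond_prob_given (Pbar x) (past (Pbar x) (state_algebra D) Z n)
        {w \<in> space (Pbar x). Z (Suc n) w \<in> A} w = measure (Z_kernel D X Pbar \<xi> \<eta> (Z n w)) A"
      if "A \<in> sets (state_algebra D)" for n A
      using cond_prob_Z[OF that, of n] AE_space
      by eventually_elim (simp only: kernel[OF Z_in])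
    ultimately show ?thesis
      using AE_Z_0 measurable_Z by (simp add: markov_chain_def)
  qed
  moreover have "AE x in m. AE w in Pbar x. \<forall>n. Z_chain X \<xi> \<eta> n w \<in> Some ` topspace D"
  proof -
    \<comment> \<open>For the empty null set only the cemetery has to be avoided; as the times are
      countable, one exceptional set serves them all.\<close>
    have "AE x in m. \<forall>n. AE w in Pbar x. Z_chain X \<xi> \<eta> n w \<noteq> None"
      using S.AE_Z_avoids_null_set[OF assms(4), of "{}"] by (simp add: AE_all_countable)
    then show ?thesis
      using AE_space
    proof eventually_elim
      case (elim x)
      then interpret fleming_viot_system D \<Omega> F P X "Pbar x" \<xi> \<eta> x
        by (intro sys) simp
      have "AE w in Pbar x. \<forall>n. Z n w \<noteq> None"
        using elim(1) by (simp add: AE_all_countable)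
      then show ?case
        using AE_space
      proof eventually_elim
        case (elim w)
        show ?case
        proof
          fix n
          show "Z n w \<in> Some ` topspace D"
            using elim(1) Z_in[OF elim(2), of n] by (auto simp del: not_None_eq)
        qed
      qed
    qed
  qed
  moreover have "(\<integral>\<^sup>+x. emeasure (Pbar x) {w \<in> space (Pbar x). Z_chain X \<xi> \<eta> 1 w \<in> Some ` A} \<partial>m) = emeasure m A"
    if A: "A \<in> sets (borel_sets_of D)" for A
  proof -
    have "emeasure (Pbar x) {w \<in> space (Pbar x). Z_chain X \<xi> \<eta> 1 w \<in> Some ` A} =
        emeasure (survivor_law (Some x)) (Some ` A)" if "x \<in> space m" for x
    proof -
      interpret fleming_viot_system D \<Omega> F P X "Pbar x" \<xi> \<eta> x
        using that by (intro sys) (simp add: space_m)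
      show ?thesis
        unfolding distr_Z_1[symmetric] emeasure_distr[OF measurable_Z image_Some_state_algebra[OF A]]
        by (intro arg_cong[where f = "emeasure (Pbar x)"]) auto
    qed
    then have "(\<integral>\<^sup>+x. emeasure (Pbar x) {w \<in> space (Pbar x). Z_chain X \<xi> \<eta> 1 w \<in> Some ` A} \<partial>m) =
        (\<integral>\<^sup>+x. emeasure (survivor_law (Some x)) (Some ` A) \<partial>m)"
      by (rule nn_integral_cong)
    then show ?thesis
      by (simp only: S.stationary[OF A])
  qed
  ultimately show ?thesis
    by blast
qed

end
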